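(* Let $(\mathcal{C},\mathbb{E},\mathfrak{s})$ be an extriangulated category satisfying Condition (WIC), and let $\xi$ be a proper class of $\mathbb{E}$-triangles in $\mathcal{C}$ such that $\mathcal{C}$ has enough $\xi$-projectives and enough $\xi$-injectives. Let $M\in\widetilde{\mathcal{GP}}(\xi)$ and let $\mathbf{N}:\ N\xrightarrow{x}N'\xrightarrow{y}N''\dashrightarrow$ be a $\mathcal{C}(\mathcal{GP}(\xi),-)$-exact $\mathbb{E}$-triangle in $\xi$. (1) There are connecting maps $\varepsilon^i_{\mathcal{GP}}(M,\mathbf{N}):\xi\mathrm{xt}^{i}_{\mathcal{GP}(\xi)}(M,N'')\to \xi\mathrm{xt}^{i+1}_{\mathcal{GP}(\xi)}(M,N)$, natural in $M$ and $\mathbf{N}$, such that the following sequence is exact: $$0\to \xi\mathrm{xt}^0_{\mathcal{GP}(\xi)}(M,N)\to\xi\mathrm{xt}^0_{\mathcal{GP}(\xi)}(M,N')\to\xi\mathrm{xt}^0_{\mathcal{GP}(\xi)}(M,N'')\to \xi\mathrm{xt}^1_{\mathcal{GP}(\xi)}(M,N)\to\cdots$$ $$\cdots\to \xi\mathrm{xt}^{n-1}_{\mathcal{GP}(\xi)}(M,N'')\to \xi\mathrm{xt}^{n}_{\mathcal{GP}(\xi)}(M,N)\to\xi\mathrm{xt}^n_{\mathcal{GP}(\xi)}(M,N')\to\xi\mathrm{xt}^n_{\mathcal{GP}(\xi)}(M,N'')\to \cdots.$$ (2) There are maps $\delta^{i}(M,N''): \xi\mathrm{xt}^{i}_{\mathcal{GP}(\xi)}(M,N'')\to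 \xi\mathrm{xt}^{i}_{\xi}(M,N'')$ and $\delta^{i}(M,N): \xi\mathrm{xt}^{i}_{\mathcal{GP}(\xi)}(M,N)\to \xi\mathrm{xt}^{i}_{\xi}(M,N)$ such that for each $i\geq0$ the diagram $$\begin{array}{ccc}\xi\mathrm{xt}^{i}_{\mathcal{GP}(\xi)}(M,N'')&\longrightarrow&\xi\mathrm{xt}^{i+1}_{\mathcal{GP}(\xi)}(M,N)\\ {\scriptstyle\delta^{i}(M,N'')}\downarrow&&\downarrow{\scriptstyle\delta^{i+1}(M,N)}\\ \xi\mathrm{xt}^{i}_{\xi}(M,N'')&\longrightarrow&\xi\mathrm{xt}^{i+1}_{\xi}(M,N)\end{array}$$ whose horizontal arrows are the connecting maps, is commutative.
   Context: **Extriangulated categories (Nakaoka--Palu).** Let $\mathcal{C}$ be an additive category with an additive bifunctor $\mathbb{E}:\mathcal{C}^{\mathrm{op}}\times\mathcal{C}\to\mathrm{Ab}$. An element $\delta\in\mathbb{E}(C,A)$ is an $\mathbb{E}$-extension; for $a:A\to A'$ and $c:C'\to C$ put $a_*\delta=\mathbb{E}(C,a)(\delta)$, $c^*\delta=\mathbb{E}(c,A)(\delta)$. A morphism from $\delta\in\mathbb{E}(C,A)$ to $\delta'\in\mathbb{E}(C',A')$ is a pair $(a:A\to A',\,c:C\to C')$ with $a_*\delta=c^*\delta'$. Sequences $A\to B\to C$ and $A\to B'\to C$ are equivalent if there is an isomorphism $B\cong B'$ compatible with the identities of $A$ and $C$. A realization $\mathfrak{s}$ assigns to each $\delta\in\mathbb{E}(C,A)$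 an equivalence class $\mathfrak{s}(\delta)=[A\xrightarrow{x}B\xrightarrow{y}C]$ such that for every morphism $(a,c):\delta\to\delta'$, with $\mathfrak{s}(\delta')=[A'\xrightarrow{x'}B'\xrightarrow{y'}C']$, there is $b:B\to B'$ with $bx=x'a$, $y'b=cy$ (then $(a,b,c)$ realizes $(a,c)$). It is additive if $\mathfrak{s}(0)=[A\to A\oplus C\to C]$ and $\mathfrak{s}(\delta\oplus\delta')=\mathfrak{s}(\delta)\oplus\mathfrak{s}(\delta')$. $(\mathcal{C},\mathbb{E},\mathfrak{s})$ is extriangulated if $\mathfrak{s}$ is an additive realization and: (ET3) if $\mathfrak{s}(\delta)=[A\xrightarrow{x}B\xrightarrow{y}C]$, $\mathfrak{s}(\delta')=[A'\xrightarrow{x'}B'\xrightarrow{y'}C']$ and $bx=x'a$, there is $c:C\to C'$ with $cy=y'b$ and $a_*\delta=c^*\delta'$; (ET3)$^{\mathrm{op}}$ the dual; (ET4) if $\delta\in\mathbb{E}(D,A)$ and $\delta'\in\mathbb{E}(F,B)$ are realized by $A\xrightarrow{f}B\xrightarrow{f'}D$ and $B\xrightarrow{g}C\xrightarrow{g'}F$, there are an object $E$, morphisms $h'\colon C\to E$, $d\colon D\to E$, $e\colon E\to F$ with $h'g=df'$, $eh'=g'$, and $\delta''\in\mathbb{E}(E,A)$ realized by $A\xrightarrow{gf}C\xrightarrow{h'}E$, such that $D\xrightarrow{d}E\xrightarrow{e}F$ realizes $f'_*\delta'$, $d^*\delta''=\delta$ and $f_*\delta''=e^*\delta'$; (ET4)$^{\mathrm{op}}$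 the dual. If $\mathfrak{s}(\delta)=[A\xrightarrow{x}B\xrightarrow{y}C]$, one calls $x$ an inflation, $y$ a deflation, and $A\xrightarrow{x}B\xrightarrow{y}C\dashrightarrow^{\delta}$ an $\mathbb{E}$-triangle; it is split if $\delta=0$. A morphism of $\mathbb{E}$-triangles is a triple $(a,b,c)$ realizing a morphism of $\mathbb{E}$-extensions. **Condition (WIC).** For composable $f,g$: if $gf$ is an inflation, so is $f$; if $gf$ is a deflation, so is $g$. **Proper class.** A class $\xi$ of $\mathbb{E}$-triangles closed under isomorphisms is proper if: it is closed under finite coproducts and contains all split $\mathbb{E}$-triangles; it is closed under base change and cobase change (if the $\mathbb{E}$-triangle of $\delta$ is in $\xi$, so are all $\mathbb{E}$-triangles realizing $c^*\delta$ or $a_*\delta$); and it is saturated: for $\mathbb{E}$-triangles $A_i\xrightarrow{x_i}B_i\xrightarrow{y_i}C\dashrightarrow^{\delta_i}$ ($i=1,2$), if the $\mathbb{E}$-triangle of $\delta_2$ and the $\mathbb{E}$-triangle $A_1\to M\to B_2$ realizing $y_2^*\delta_1$ are in $\xi$, then the $\mathbb{E}$-triangle of $\delta_1$ is in $\xi$. **Projectives and injectives.** $P$ is $\xi$-projective if $0\to\mathcal{C}(P,A)\to\mathcal{C}(P,B)\to\mathcal{C}(P,C)\to0$ is exact for every $A\to B\to C\dashrightarrow$ in $\xi$; $\xi$-injective is dual. $\mathcal{P}(\xi)$, $\mathcal{I}(\xi)$ denote these classes. Enough $\xi$-projectives: each object $A$ fits in an $\mathbb{E}$-triangle $K\to P\to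 A\dashrightarrow$ in $\xi$ with $P\in\mathcal{P}(\xi)$; enough $\xi$-injectives: dual. **Exactness.** For a class $\mathcal{W}$ of objects, an $\mathbb{E}$-triangle $A\to B\to C\dashrightarrow$ in $\xi$ is $\mathcal{C}(-,\mathcal{W})$-exact if $0\to\mathcal{C}(C,W)\to\mathcal{C}(B,W)\to\mathcal{C}(A,W)\to0$ is exact for all $W\in\mathcal{W}$, and $\mathcal{C}(\mathcal{W},-)$-exact if $0\to\mathcal{C}(W,A)\to\mathcal{C}(W,B)\to\mathcal{C}(W,C)\to0$ is exact for all $W\in\mathcal{W}$. A complex $\cdots\to X_1\xrightarrow{d_1}X_0\xrightarrow{d_0}X_{-1}\to\cdots$ is $\xi$-exact if there are $\mathbb{E}$-triangles $K_{n+1}\xrightarrow{g_n}X_n\xrightarrow{f_n}K_n\dashrightarrow$ in $\xi$ with $d_n=g_{n-1}f_n$ for all $n$; it is $\mathcal{C}(-,\mathcal{W})$-exact if these can be chosen $\mathcal{C}(-,\mathcal{W})$-exact. **Gorenstein objects and dimension.** A complete $\xi$-projective resolution is a $\mathcal{C}(-,\mathcal{P}(\xi))$-exact complex with all terms in $\mathcal{P}(\xi)$; the objects $K_n$ in its $\mathcal{C}(-,\mathcal{P}(\xi))$-exact $\mathbb{E}$-triangles are called $\xi$-$\mathcal{G}$projective, and form the class $\mathcal{GP}(\xi)$. $\xi$-$\mathcal{G}\mathrm{pd}A=0$ if $A\in\mathcal{GP}(\xi)$; for $n>0$, $\xi$-$\mathcal{G}\mathrm{pd}A\le n$ if there is an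 $\mathbb{E}$-triangle $K\to G\to A\dashrightarrow$ in $\xi$ with $G\in\mathcal{GP}(\xi)$ and $\xi$-$\mathcal{G}\mathrm{pd}K\le n-1$; $\xi$-$\mathcal{G}\mathrm{pd}A$ is the least such $n$, or $\infty$. $\widetilde{\mathcal{GP}}(\xi)$ is the full subcategory of objects with $\xi$-$\mathcal{G}\mathrm{pd}<\infty$. **$\xi$-cohomology.** A $\xi$-projective resolution $\pi:\mathbf{P}\to M$ is a $\xi$-exact complex $\cdots\to P_1\to P_0\to M\to0$ with all $P_n\in\mathcal{P}(\xi)$; $\mathbf{P}$ is the deleted complex $\cdots\to P_1\to P_0\to0$. Define $\xi\mathrm{xt}^n_{\xi}(M,N)=H^n(\mathcal{C}(\mathbf{P},N))$ for $n\ge0$ (independent of the choice of $\mathbf{P}$). For an $\mathbb{E}$-triangle $N\to N'\to N''\dashrightarrow$ in $\xi$, the connecting maps $\xi\mathrm{xt}^i_\xi(M,N'')\to\xi\mathrm{xt}^{i+1}_\xi(M,N)$ are those of the short exact sequence of complexes $0\to\mathcal{C}(\mathbf{P},N)\to\mathcal{C}(\mathbf{P},N')\to\mathcal{C}(\mathbf{P},N'')\to0$. **$\xi$-Gorenstein cohomology.** A $\xi$-$\mathcal{G}$projective resolution $\mathbf{G}\to M$ is a $\xi$-exact complex $\cdots\to G_1\to G_0\to M\to0$ with $G_i\in\mathcal{GP}(\xi)$ whose $\mathbb{E}$-triangles $K_{i+1}\to G_i\to K_i\dashrightarrow$ ($i\ge0$, $K_0=M$) are in $\xi$ and $\mathcal{C}(\mathcal{GP}(\xi),-)$-exact.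 Every object of $\widetilde{\mathcal{GP}}(\xi)$ admits one. For $i\ge0$ define $\xi\mathrm{xt}^i_{\mathcal{GP}(\xi)}(M,N)=H^i(\mathcal{C}(\mathbf{G},N))$ with $\mathbf{G}$ the deleted complex (independent of the choice). *)

theory Defs
  imports "HOL-Algebra.Exact_Sequence" "HOL-Library.Extended_Nat"
begin

section \<open>Extriangulated categories\<close>

text \<open>
  Abelian groups are HOL-Algebra groups satisfying \<open>comm_group\<close>; hence the sum of two morphisms
  or of two extensions is written with \<open>\<otimes>\<close>, and \<open>\<one>\<close> is the zero morphism or the zero extension.
  \<open>Ext \<C> C A\<close> is $\mathbb{E}(C,A)$, \<open>Push \<C> a\<close> is $a_*$, \<open>Pull \<C> c\<close> is $c^*$, and
  \<open>Rlz \<C> C A \<delta>\<close> is the realization $\mathfrak{s}(\delta)$ for $\delta\in\mathbb{E}(C,A)$, a set of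
  triples \<open>(B, x, y)\<close> standing for sequences $A\to B\to C$.

  Composition, \<open>Push\<close> and \<open>Pull\<close> do not take the objects involved as arguments. This is no loss of
  generality, because morphisms and extensions may be tagged with their objects; on the other
  hand, disjointness of the hom-sets is not required.
\<close>

record ('o, 'm, 'e) excat =
  Obj :: "'o set"
  Hom :: "'o \<Rightarrow> 'o \<Rightarrow> 'm monoid"
  Idn :: "'o \<Rightarrow> 'm"
  Cmp :: "'m \<Rightarrow> 'm \<Rightarrow> 'm"  (infixr \<open>\<cdot>\<index>\<close> 75)
  Ext :: "'o \<Rightarrow> 'o \<Rightarrow> 'e monoid"
  Push :: "'m \<Rightarrow> 'e \<Rightarrow> 'e"
  Pull :: "'m \<Rightarrow> 'e \<Rightarrow> 'e"
  Rlz :: "'o \<Rightarrow> 'o \<Rightarrow> 'e \<Rightarrow> ('o \<times> 'm \<times> 'm) set"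

abbreviation Mor :: "('o, 'm, 'e) excat \<Rightarrow> 'o \<Rightarrow> 'o \<Rightarrow> 'm set"
  where "Mor \<C> A B \<equiv> carrier (Hom \<C> A B)"

abbreviation Exts :: "('o, 'm, 'e) excat \<Rightarrow> 'o \<Rightarrow> 'o \<Rightarrow> 'e set"
  where "Exts \<C> C A \<equiv> carrier (Ext \<C> C A)"

locale preadditive_category =
  fixes \<C> :: "('o, 'm, 'e) excat" (structure)
  assumes hom_comm_group: "\<lbrakk>A \<in> Obj \<C>; B \<in> Obj \<C>\<rbrakk> \<Longrightarrow> comm_group (Hom \<C> A B)"
    and id_closed: "A \<in> Obj \<C> \<Longrightarrow> Idn \<C> A \<in> Mor \<C> A A"
    and comp_closed: "\<lbrakk>A \<in> Obj \<C>; B \<in> Obj \<C>; C \<in> Obj \<C>; f \<in> Mor \<C> A B; g \<in> Mor \<C> B C\<rbrakk>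
          \<Longrightarrow> g \<cdot> f \<in> Mor \<C> A C"
    and comp_assoc: "\<lbrakk>A \<in> Obj \<C>; B \<in> Obj \<C>; C \<in> Obj \<C>; D \<in> Obj \<C>;
            f \<in> Mor \<C> A B; g \<in> Mor \<C> B C; h \<in> Mor \<C> C D\<rbrakk>
          \<Longrightarrow> (h \<cdot> g) \<cdot> f = h \<cdot> (g \<cdot> f)"
    and id_comp: "\<lbrakk>A \<in> Obj \<C>; B \<in> Obj \<C>; f \<in> Mor \<C> A B\<rbrakk> \<Longrightarrow> Idn \<C> B \<cdot> f = f"
    and comp_id: "\<lbrakk>A \<in> Obj \<C>; B \<in> Obj \<C>; f \<in> Mor \<C> A B\<rbrakk> \<Longrightarrow> f \<cdot> Idn \<C> A = f"
    and comp_add: "\<lbrakk>A \<in> Obj \<C>; B \<in> Obj \<C>; C \<in> Obj \<C>;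
            f \<in> Mor \<C> A B; f' \<in> Mor \<C> A B; g \<in> Mor \<C> B C\<rbrakk>
          \<Longrightarrow> g \<cdot> (f \<otimes>\<^bsub>Hom \<C> A B\<^esub> f') = (g \<cdot> f) \<otimes>\<^bsub>Hom \<C> A C\<^esub> (g \<cdot> f')"
    and add_comp: "\<lbrakk>A \<in> Obj \<C>; B \<in> Obj \<C>; C \<in> Obj \<C>;
            f \<in> Mor \<C> A B; g \<in> Mor \<C> B C; g' \<in> Mor \<C> B C\<rbrakk>
          \<Longrightarrow> (g \<otimes>\<^bsub>Hom \<C> B C\<^esub> g') \<cdot> f = (g \<cdot> f) \<otimes>\<^bsub>Hom \<C> A C\<^esub> (g' \<cdot> f)"

definition is_iso :: "('o, 'm, 'e) excat \<Rightarrow> 'o \<Rightarrow> 'o \<Rightarrow> 'm \<Rightarrow> bool"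
  where "is_iso \<C> A B f \<longleftrightarrow> f \<in> Mor \<C> A B \<and>
    (\<exists>g \<in> Mor \<C> B A. g \<cdot>\<^bsub>\<C>\<^esub> f = Idn \<C> A \<and> f \<cdot>\<^bsub>\<C>\<^esub> g = Idn \<C> B)"

definition zero_object :: "('o, 'm, 'e) excat \<Rightarrow> 'o \<Rightarrow> bool"
  where "zero_object \<C> Z \<longleftrightarrow> Z \<in> Obj \<C> \<and>
    (\<forall>A \<in> Obj \<C>. Mor \<C> A Z = {\<one>\<^bsub>Hom \<C> A Z\<^esub>} \<and> Mor \<C> Z A = {\<one>\<^bsub>Hom \<C> Z A\<^esub>})"

record ('o, 'm) bip =
  Sum :: 'o
  inj1 :: 'm
  inj2 :: 'm
  prj1 :: 'm
  prj2 :: 'm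

definition biproduct :: "('o, 'm, 'e) excat \<Rightarrow> 'o \<Rightarrow> 'o \<Rightarrow> ('o, 'm) bip \<Rightarrow> bool"
  where "biproduct \<C> A B S \<longleftrightarrow> Sum S \<in> Obj \<C> \<and>
    inj1 S \<in> Mor \<C> A (Sum S) \<and> inj2 S \<in> Mor \<C> B (Sum S) \<and>
    prj1 S \<in> Mor \<C> (Sum S) A \<and> prj2 S \<in> Mor \<C> (Sum S) B \<and>
    prj1 S \<cdot>\<^bsub>\<C>\<^esub> inj1 S = Idn \<C> A \<and> prj2 S \<cdot>\<^bsub>\<C>\<^esub> inj2 S = Idn \<C> B \<and>
    prj1 S \<cdot>\<^bsub>\<C>\<^esub> inj2 S = \<one>\<^bsub>Hom \<C> B A\<^esub> \<and> prj2 S \<cdot>\<^bsub>\<C>\<^esub> inj1 S = \<one>\<^bsub>Hom \<C> A B\<^esub> \<and>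
    (inj1 S \<cdot>\<^bsub>\<C>\<^esub> prj1 S) \<otimes>\<^bsub>Hom \<C> (Sum S) (Sum S)\<^esub> (inj2 S \<cdot>\<^bsub>\<C>\<^esub> prj2 S) = Idn \<C> (Sum S)"

locale additive_category = preadditive_category +
  assumes ex_zero_object: "\<exists>Z. zero_object \<C> Z"
    and ex_biproduct: "\<lbrakk>A \<in> Obj \<C>; B \<in> Obj \<C>\<rbrakk> \<Longrightarrow> \<exists>S. biproduct \<C> A B S"

definition sum_mor :: "('o, 'm, 'e) excat \<Rightarrow> ('o, 'm) bip \<Rightarrow> ('o, 'm) bip \<Rightarrow> 'm \<Rightarrow> 'm \<Rightarrow> 'm"
  where "sum_mor \<C> S T f f' =
    (inj1 T \<cdot>\<^bsub>\<C>\<^esub> f \<cdot>\<^bsub>\<C>\<^esub> prj1 S) \<otimes>\<^bsub>Hom \<C> (Sum S) (Sum T)\<^esub> (inj2 T \<cdot>\<^bsub>\<C>\<^esub> f' \<cdot>\<^bsub>\<C>\<^esub> prj2 S)"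

text \<open>
  $\delta\oplus\delta'\in\mathbb{E}(C\oplus C',A\oplus A')$ is the element with components
  $(\delta,0,0,\delta')$ in
  $\mathbb{E}(C,A)\oplus\mathbb{E}(C,A')\oplus\mathbb{E}(C',A)\oplus\mathbb{E}(C',A')$.
\<close>

definition sum_ext :: "('o, 'm, 'e) excat \<Rightarrow> ('o, 'm) bip \<Rightarrow> ('o, 'm) bip \<Rightarrow> 'e \<Rightarrow> 'e \<Rightarrow> 'e"
  where "sum_ext \<C> SC SA \<delta> \<delta>' =
    Push \<C> (inj1 SA) (Pull \<C> (prj1 SC) \<delta>) \<otimes>\<^bsub>Ext \<C> (Sum SC) (Sum SA)\<^esub>
    Push \<C> (inj2 SA) (Pull \<C> (prj2 SC) \<delta>')"

locale ext_bifunctor = additive_category +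
  assumes ext_comm_group: "\<lbrakk>C \<in> Obj \<C>; A \<in> Obj \<C>\<rbrakk> \<Longrightarrow> comm_group (Ext \<C> C A)"
    and push_hom: "\<lbrakk>C \<in> Obj \<C>; A \<in> Obj \<C>; A' \<in> Obj \<C>; a \<in> Mor \<C> A A'\<rbrakk>
          \<Longrightarrow> Push \<C> a \<in> hom (Ext \<C> C A) (Ext \<C> C A')"
    and pull_hom: "\<lbrakk>C \<in> Obj \<C>; C' \<in> Obj \<C>; A \<in> Obj \<C>; c \<in> Mor \<C> C' C\<rbrakk>
          \<Longrightarrow> Pull \<C> c \<in> hom (Ext \<C> C A) (Ext \<C> C' A)"
    and push_id: "\<lbrakk>C \<in> Obj \<C>; A \<in> Obj \<C>; \<delta> \<in> Exts \<C> C A\<rbrakk> \<Longrightarrow> Push \<C> (Idn \<C> A) \<delta> = \<delta>"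
    and pull_id: "\<lbrakk>C \<in> Obj \<C>; A \<in> Obj \<C>; \<delta> \<in> Exts \<C> C A\<rbrakk> \<Longrightarrow> Pull \<C> (Idn \<C> C) \<delta> = \<delta>"
    and push_comp: "\<lbrakk>C \<in> Obj \<C>; A \<in> Obj \<C>; A' \<in> Obj \<C>; A'' \<in> Obj \<C>;
            a \<in> Mor \<C> A A'; a' \<in> Mor \<C> A' A''; \<delta> \<in> Exts \<C> C A\<rbrakk>
          \<Longrightarrow> Push \<C> (a' \<cdot> a) \<delta> = Push \<C> a' (Push \<C> a \<delta>)"
    and pull_comp: "\<lbrakk>C \<in> Obj \<C>; C' \<in> Obj \<C>; C'' \<in> Obj \<C>; A \<in> Obj \<C>;
            c \<in> Mor \<C> C' C; c' \<in> Mor \<C> C'' C'; \<delta> \<in> Exts \<C> C A\<rbrakk>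
          \<Longrightarrow> Pull \<C> (c \<cdot> c') \<delta> = Pull \<C> c' (Pull \<C> c \<delta>)"
    and push_pull: "\<lbrakk>C \<in> Obj \<C>; C' \<in> Obj \<C>; A \<in> Obj \<C>; A' \<in> Obj \<C>;
            a \<in> Mor \<C> A A'; c \<in> Mor \<C> C' C; \<delta> \<in> Exts \<C> C A\<rbrakk>
          \<Longrightarrow> Push \<C> a (Pull \<C> c \<delta>) = Pull \<C> c (Push \<C> a \<delta>)"
    and push_add: "\<lbrakk>C \<in> Obj \<C>; A \<in> Obj \<C>; A' \<in> Obj \<C>;
            a \<in> Mor \<C> A A'; a' \<in> Mor \<C> A A'; \<delta> \<in> Exts \<C> C A\<rbrakk>
          \<Longrightarrow> Push \<C> (a \<otimes>\<^bsub>Hom \<C> A A'\<^esub> a') \<delta> = Push \<C> a \<delta> \<otimes>\<^bsub>Ext \<C> C A'\<^esub> Push \<C> a' \<delta>"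
    and pull_add: "\<lbrakk>C \<in> Obj \<C>; C' \<in> Obj \<C>; A \<in> Obj \<C>;
            c \<in> Mor \<C> C' C; c' \<in> Mor \<C> C' C; \<delta> \<in> Exts \<C> C A\<rbrakk>
          \<Longrightarrow> Pull \<C> (c \<otimes>\<^bsub>Hom \<C> C' C\<^esub> c') \<delta> = Pull \<C> c \<delta> \<otimes>\<^bsub>Ext \<C> C' A\<^esub> Pull \<C> c' \<delta>"

definition seqs :: "('o, 'm, 'e) excat \<Rightarrow> 'o \<Rightarrow> 'o \<Rightarrow> ('o \<times> 'm \<times> 'm) set"
  where "seqs \<C> A C = {(B, x, y). B \<in> Obj \<C> \<and> x \<in> Mor \<C> A B \<and> y \<in> Mor \<C> B C}"

definition seq_equiv :: "('o, 'm, 'e) excat \<Rightarrow> 'o \<Rightarrow> 'o \<Rightarrow> ('o \<times> 'm \<times> 'm) rel"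
  where "seq_equiv \<C> A C = {((B, x, y), (B', x', y')).
    (B, x, y) \<in> seqs \<C> A C \<and> (B', x', y') \<in> seqs \<C> A C \<and>
    (\<exists>b. is_iso \<C> B B' b \<and> b \<cdot>\<^bsub>\<C>\<^esub> x = x' \<and> y' \<cdot>\<^bsub>\<C>\<^esub> b = y)}"

text \<open>\<open>(A, x, B, y, C, \<delta>)\<close> stands for $A\xrightarrow{x}B\xrightarrow{y}C\dashrightarrow^{\delta}$.\<close>

type_synonym ('o, 'm, 'e) triangle = "'o \<times> 'm \<times> 'o \<times> 'm \<times> 'o \<times> 'e"

definition etriangles :: "('o, 'm, 'e) excat \<Rightarrow> ('o, 'm, 'e) triangle set"
  where "etriangles \<C> = {(A, x, B, y, C, \<delta>). A \<in> Obj \<C> \<and> C \<in> Obj \<C> \<and>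
    \<delta> \<in> Exts \<C> C A \<and> (B, x, y) \<in> Rlz \<C> C A \<delta>}"

locale extriangulated_category = ext_bifunctor +
  assumes rlz_class: "\<lbrakk>A \<in> Obj \<C>; C \<in> Obj \<C>; \<delta> \<in> Exts \<C> C A\<rbrakk>
          \<Longrightarrow> Rlz \<C> C A \<delta> \<in> seqs \<C> A C // seq_equiv \<C> A C"
    and rlz_mor: "\<lbrakk>(A, x, B, y, C, \<delta>) \<in> etriangles \<C>; (A', x', B', y', C', \<delta>') \<in> etriangles \<C>;
            a \<in> Mor \<C> A A'; c \<in> Mor \<C> C C'; Push \<C> a \<delta> = Pull \<C> c \<delta>'\<rbrakk>
          \<Longrightarrow> \<exists>b \<in> Mor \<C> B B'. b \<cdot> x = x' \<cdot> a \<and> y' \<cdot> b = c \<cdot> y"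
    and rlz_zero: "\<lbrakk>A \<in> Obj \<C>; C \<in> Obj \<C>; biproduct \<C> A C S\<rbrakk>
          \<Longrightarrow> (Sum S, inj1 S, prj2 S) \<in> Rlz \<C> C A \<one>\<^bsub>Ext \<C> C A\<^esub>"
    and rlz_sum: "\<lbrakk>(A, x, B, y, C, \<delta>) \<in> etriangles \<C>; (A', x', B', y', C', \<delta>') \<in> etriangles \<C>;
            biproduct \<C> A A' SA; biproduct \<C> B B' SB; biproduct \<C> C C' SC\<rbrakk>
          \<Longrightarrow> (Sum SB, sum_mor \<C> SA SB x x', sum_mor \<C> SB SC y y')
                \<in> Rlz \<C> (Sum SC) (Sum SA) (sum_ext \<C> SC SA \<delta> \<delta>')"
    and ET3: "\<lbrakk>(A, x, B, y, C, \<delta>) \<in> etriangles \<C>; (A', x', B', y', C', \<delta>') \<in> etriangles \<C>;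
            a \<in> Mor \<C> A A'; b \<in> Mor \<C> B B'; b \<cdot> x = x' \<cdot> a\<rbrakk>
          \<Longrightarrow> \<exists>c \<in> Mor \<C> C C'. c \<cdot> y = y' \<cdot> b \<and> Push \<C> a \<delta> = Pull \<C> c \<delta>'"
    and ET3_op: "\<lbrakk>(A, x, B, y, C, \<delta>) \<in> etriangles \<C>; (A', x', B', y', C', \<delta>') \<in> etriangles \<C>;
            b \<in> Mor \<C> B B'; c \<in> Mor \<C> C C'; c \<cdot> y = y' \<cdot> b\<rbrakk>
          \<Longrightarrow> \<exists>a \<in> Mor \<C> A A'. b \<cdot> x = x' \<cdot> a \<and> Push \<C> a \<delta> = Pull \<C> c \<delta>'"
    and ET4: "\<lbrakk>(A, f, B, f', D, \<delta>) \<in> etriangles \<C>; (B, g, C, g', F, \<delta>') \<in> etriangles \<C>\<rbrakk>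
          \<Longrightarrow> \<exists>E \<in> Obj \<C>. \<exists>h' \<in> Mor \<C> C E. \<exists>d \<in> Mor \<C> D E. \<exists>e \<in> Mor \<C> E F. \<exists>\<delta>'' \<in> Exts \<C> E A.
                h' \<cdot> g = d \<cdot> f' \<and> e \<cdot> h' = g' \<and>
                (A, g \<cdot> f, C, h', E, \<delta>'') \<in> etriangles \<C> \<and>
                (D, d, E, e, F, Push \<C> f' \<delta>') \<in> etriangles \<C> \<and>
                Pull \<C> d \<delta>'' = \<delta> \<and> Push \<C> f \<delta>'' = Pull \<C> e \<delta>'"
    and ET4_op: "\<lbrakk>(D, f', B, f, A, \<delta>) \<in> etriangles \<C>; (F, g', C, g, B, \<delta>') \<in> etriangles \<C>\<rbrakk>
          \<Longrightarrow> \<exists>E \<in> Obj \<C>. \<exists>h' \<in> Mor \<C> E C. \<exists>d \<in> Mor \<C> E D. \<exists>e \<in> Mor \<C> F E. \<exists>\<delta>'' \<in> Exts \<C> A E.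
                g \<cdot> h' = f' \<cdot> d \<and> h' \<cdot> e = g' \<and>
                (E, h', C, f \<cdot> g, A, \<delta>'') \<in> etriangles \<C> \<and>
                (F, e, E, d, D, Pull \<C> f' \<delta>') \<in> etriangles \<C> \<and>
                Push \<C> d \<delta>'' = \<delta> \<and> Pull \<C> f \<delta>'' = Push \<C> e \<delta>'"

definition inflation :: "('o, 'm, 'e) excat \<Rightarrow> 'o \<Rightarrow> 'o \<Rightarrow> 'm \<Rightarrow> bool"
  where "inflation \<C> A B x \<longleftrightarrow> (\<exists>y C \<delta>. (A, x, B, y, C, \<delta>) \<in> etriangles \<C>)"

definition deflation :: "('o, 'm, 'e) excat \<Rightarrow> 'o \<Rightarrow> 'o \<Rightarrow> 'm \<Rightarrow> bool"
  where "deflation \<C> B C y \<longleftrightarrow> (\<exists>A x \<delta>. (A, x, B, y, C, \<delta>) \<in> etriangles \<C>)"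

definition WIC :: "('o, 'm, 'e) excat \<Rightarrow> bool"
  where "WIC \<C> \<longleftrightarrow> (\<forall>A \<in> Obj \<C>. \<forall>B \<in> Obj \<C>. \<forall>C \<in> Obj \<C>. \<forall>f \<in> Mor \<C> A B. \<forall>g \<in> Mor \<C> B C.
    (inflation \<C> A C (g \<cdot>\<^bsub>\<C>\<^esub> f) \<longrightarrow> inflation \<C> A B f) \<and>
    (deflation \<C> A C (g \<cdot>\<^bsub>\<C>\<^esub> f) \<longrightarrow> deflation \<C> B C g))"

fun triangle_mor ::
  "('o, 'm, 'e) excat \<Rightarrow> ('o, 'm, 'e) triangle \<Rightarrow> ('o, 'm, 'e) triangle \<Rightarrow> 'm \<Rightarrow> 'm \<Rightarrow> 'm \<Rightarrow> bool"
  where "triangle_mor \<C> (A, x, B, y, C, \<delta>) (A', x', B', y', C', \<delta>') a b c \<longleftrightarrow>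
    a \<in> Mor \<C> A A' \<and> b \<in> Mor \<C> B B' \<and> c \<in> Mor \<C> C C' \<and>
    Push \<C> a \<delta> = Pull \<C> c \<delta>' \<and> b \<cdot>\<^bsub>\<C>\<^esub> x = x' \<cdot>\<^bsub>\<C>\<^esub> a \<and> y' \<cdot>\<^bsub>\<C>\<^esub> b = c \<cdot>\<^bsub>\<C>\<^esub> y"


section \<open>Proper classes, projectives, injectives\<close>

text \<open>
  Closure under finite coproducts is closure under binary ones; the empty coproduct is split.
\<close>

locale proper_class =
  fixes \<C> :: "('o, 'm, 'e) excat" (structure) and \<xi> :: "('o, 'm, 'e) triangle set"
  assumes etriangle: "\<xi> \<subseteq> etriangles \<C>"
    and iso_closed: "\<lbrakk>(A, x, B, y, C, \<delta>) \<in> \<xi>; (A', x', B', y', C', \<delta>') \<in> etriangles \<C>;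
            triangle_mor \<C> (A, x, B, y, C, \<delta>) (A', x', B', y', C', \<delta>') a b c;
            is_iso \<C> A A' a; is_iso \<C> B B' b; is_iso \<C> C C' c\<rbrakk>
          \<Longrightarrow> (A', x', B', y', C', \<delta>') \<in> \<xi>"
    and coproduct_closed: "\<lbrakk>(A, x, B, y, C, \<delta>) \<in> \<xi>; (A', x', B', y', C', \<delta>') \<in> \<xi>;
            biproduct \<C> A A' SA; biproduct \<C> B B' SB; biproduct \<C> C C' SC\<rbrakk>
          \<Longrightarrow> (Sum SA, sum_mor \<C> SA SB x x', Sum SB, sum_mor \<C> SB SC y y', Sum SC,
                sum_ext \<C> SC SA \<delta> \<delta>') \<in> \<xi>"
    and split: "(A, x, B, y, C, \<one>\<^bsub>Ext \<C> C A\<^esub>) \<in> etriangles \<C>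
          \<Longrightarrow> (A, x, B, y, C, \<one>\<^bsub>Ext \<C> C A\<^esub>) \<in> \<xi>"
    and base_change: "\<lbrakk>(A, x, B, y, C, \<delta>) \<in> \<xi>; C' \<in> Obj \<C>; c \<in> Mor \<C> C' C;
            (A, x', B', y', C', Pull \<C> c \<delta>) \<in> etriangles \<C>\<rbrakk>
          \<Longrightarrow> (A, x', B', y', C', Pull \<C> c \<delta>) \<in> \<xi>"
    and cobase_change: "\<lbrakk>(A, x, B, y, C, \<delta>) \<in> \<xi>; A' \<in> Obj \<C>; a \<in> Mor \<C> A A';
            (A', x', B', y', C, Push \<C> a \<delta>) \<in> etriangles \<C>\<rbrakk>
          \<Longrightarrow> (A', x', B', y', C, Push \<C> a \<delta>) \<in> \<xi>"
    and saturated: "\<lbrakk>(A1, x1, B1, y1, C, \<delta>1) \<in> etriangles \<C>; (A2, x2, B2, y2, C, \<delta>2) \<in> \<xi>;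
            (A1, m, M, n, B2, Pull \<C> y2 \<delta>1) \<in> \<xi>\<rbrakk>
          \<Longrightarrow> (A1, x1, B1, y1, C, \<delta>1) \<in> \<xi>"

text \<open>
  \<open>cov_exact \<C> \<W>\<close> is $\mathcal{C}(\mathcal{W},-)$-exactness and \<open>con_exact \<C> \<W>\<close> is
  $\mathcal{C}(-,\mathcal{W})$-exactness. Note that \<open>short_exact_sequence\<close> lists its groups and maps
  from the right end of the sequence to the left.
\<close>

fun cov_exact :: "('o, 'm, 'e) excat \<Rightarrow> 'o set \<Rightarrow> ('o, 'm, 'e) triangle \<Rightarrow> bool"
  where "cov_exact \<C> \<W> (A, x, B, y, C, \<delta>) \<longleftrightarrow> (\<forall>W \<in> \<W>.
    short_exact_sequence (Hom \<C> W C) (Hom \<C> W B) (Hom \<C> W A) (\<lambda>f. y \<cdot>\<^bsub>\<C>\<^esub> f) (\<lambda>f. x \<cdot>\<^bsub>\<C>\<^esub> f))"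

fun con_exact :: "('o, 'm, 'e) excat \<Rightarrow> 'o set \<Rightarrow> ('o, 'm, 'e) triangle \<Rightarrow> bool"
  where "con_exact \<C> \<W> (A, x, B, y, C, \<delta>) \<longleftrightarrow> (\<forall>W \<in> \<W>.
    short_exact_sequence (Hom \<C> A W) (Hom \<C> B W) (Hom \<C> C W) (\<lambda>f. f \<cdot>\<^bsub>\<C>\<^esub> x) (\<lambda>f. f \<cdot>\<^bsub>\<C>\<^esub> y))"

definition Proj :: "('o, 'm, 'e) excat \<Rightarrow> ('o, 'm, 'e) triangle set \<Rightarrow> 'o set"
  where "Proj \<C> \<xi> = {P \<in> Obj \<C>. \<forall>T \<in> \<xi>. cov_exact \<C> {P} T}"

definition Inj :: "('o, 'm, 'e) excat \<Rightarrow> ('o, 'm, 'e) triangle set \<Rightarrow> 'o set"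
  where "Inj \<C> \<xi> = {I \<in> Obj \<C>. \<forall>T \<in> \<xi>. con_exact \<C> {I} T}"

definition enough_projectives :: "('o, 'm, 'e) excat \<Rightarrow> ('o, 'm, 'e) triangle set \<Rightarrow> bool"
  where "enough_projectives \<C> \<xi> \<longleftrightarrow>
    (\<forall>A \<in> Obj \<C>. \<exists>K x P y \<delta>. P \<in> Proj \<C> \<xi> \<and> (K, x, P, y, A, \<delta>) \<in> \<xi>)"

definition enough_injectives :: "('o, 'm, 'e) excat \<Rightarrow> ('o, 'm, 'e) triangle set \<Rightarrow> bool"
  where "enough_injectives \<C> \<xi> \<longleftrightarrow>
    (\<forall>A \<in> Obj \<C>. \<exists>x I y K \<delta>. I \<in> Inj \<C> \<xi> \<and> (A, x, I, y, K, \<delta>) \<in> \<xi>)"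


section \<open>Gorenstein projective objects and dimension\<close>

definition complete_proj_resolution ::
  "('o, 'm, 'e) excat \<Rightarrow> ('o, 'm, 'e) triangle set \<Rightarrow> (int \<Rightarrow> 'o) \<Rightarrow> (int \<Rightarrow> 'm) \<Rightarrow>
    (int \<Rightarrow> 'o) \<Rightarrow> (int \<Rightarrow> 'm) \<Rightarrow> (int \<Rightarrow> 'm) \<Rightarrow> (int \<Rightarrow> 'e) \<Rightarrow> bool"
  where "complete_proj_resolution \<C> \<xi> X d K g f \<theta> \<longleftrightarrow> (\<forall>n.
    X n \<in> Proj \<C> \<xi> \<and>
    (K (n + 1), g n, X n, f n, K n, \<theta> n) \<in> \<xi> \<and>
    con_exact \<C> (Proj \<C> \<xi>) (K (n + 1), g n, X n, f n, K n, \<theta> n) \<and>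
    d n = g (n - 1) \<cdot>\<^bsub>\<C>\<^esub> f n)"

definition GProj :: "('o, 'm, 'e) excat \<Rightarrow> ('o, 'm, 'e) triangle set \<Rightarrow> 'o set"
  where "GProj \<C> \<xi> = {A. \<exists>X d K g f \<theta> n. complete_proj_resolution \<C> \<xi> X d K g f \<theta> \<and> A = K n}"

primrec Gpd_le :: "('o, 'm, 'e) excat \<Rightarrow> ('o, 'm, 'e) triangle set \<Rightarrow> nat \<Rightarrow> 'o \<Rightarrow> bool"
  where
    "Gpd_le \<C> \<xi> 0 A \<longleftrightarrow> A \<in> GProj \<C> \<xi>"
  | "Gpd_le \<C> \<xi> (Suc n) A \<longleftrightarrow>
      (\<exists>K x G y \<delta>. (K, x, G, y, A, \<delta>) \<in> \<xi> \<and> G \<in> GProj \<C> \<xi> \<and> Gpd_le \<C> \<xi> n K)"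

definition Gpd :: "('o, 'm, 'e) excat \<Rightarrow> ('o, 'm, 'e) triangle set \<Rightarrow> 'o \<Rightarrow> enat"
  where "Gpd \<C> \<xi> A = (INF n \<in> {n. Gpd_le \<C> \<xi> n A}. enat n)"

definition finite_Gpd :: "('o, 'm, 'e) excat \<Rightarrow> ('o, 'm, 'e) triangle set \<Rightarrow> 'o set"
  where "finite_Gpd \<C> \<xi> = {A \<in> Obj \<C>. Gpd \<C> \<xi> A < \<infinity>}"


section \<open>Resolutions\<close>

text \<open>
  An augmented complex $\cdots\to X_1\to X_0\to M$: \<open>cdif R n\<close> is the differential
  $X_{n+1}\to X_n$ and \<open>caug R\<close> is $X_0\to M$. The deleted complex is given by \<open>cob\<close> and \<open>cdif\<close>.
\<close>

record ('o, 'm) aug_complex =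
  cob :: "nat \<Rightarrow> 'o"
  cdif :: "nat \<Rightarrow> 'm"
  caug :: 'm

text \<open>
  Terms in \<open>\<X>\<close>, and $\mathbb{E}$-triangles $K_{n+1}\to X_n\to K_n\dashrightarrow$ in \<open>\<T>\<close> with $K_0=M$.
\<close>

definition resolution_by ::
  "('o, 'm, 'e) excat \<Rightarrow> 'o set \<Rightarrow> ('o, 'm, 'e) triangle set \<Rightarrow> 'o \<Rightarrow> ('o, 'm) aug_complex \<Rightarrow> bool"
  where "resolution_by \<C> \<X> \<T> M R \<longleftrightarrow> (\<exists>K g f \<theta>. K 0 = M \<and> caug R = f 0 \<and> (\<forall>n.
    cob R n \<in> \<X> \<and>
    (K (Suc n), g n, cob R n, f n, K n, \<theta> n) \<in> \<T> \<and>
    cdif R n = g n \<cdot>\<^bsub>\<C>\<^esub> f (Suc n)))"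

definition GP_exact_triangles ::
  "('o, 'm, 'e) excat \<Rightarrow> ('o, 'm, 'e) triangle set \<Rightarrow> ('o, 'm, 'e) triangle set"
  where "GP_exact_triangles \<C> \<xi> = {T \<in> \<xi>. cov_exact \<C> (GProj \<C> \<xi>) T}"

definition proj_resolution ::
  "('o, 'm, 'e) excat \<Rightarrow> ('o, 'm, 'e) triangle set \<Rightarrow> 'o \<Rightarrow> ('o, 'm) aug_complex \<Rightarrow> bool"
  where "proj_resolution \<C> \<xi> M P \<longleftrightarrow> resolution_by \<C> (Proj \<C> \<xi>) \<xi> M P"

definition Gproj_resolution ::
  "('o, 'm, 'e) excat \<Rightarrow> ('o, 'm, 'e) triangle set \<Rightarrow> 'o \<Rightarrow> ('o, 'm) aug_complex \<Rightarrow> bool"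
  where "Gproj_resolution \<C> \<xi> M G \<longleftrightarrow>
    resolution_by \<C> (GProj \<C> \<xi>) (GP_exact_triangles \<C> \<xi>) M G"

text \<open>\<open>\<phi>\<close> is a chain map from \<open>R\<close> (over \<open>M\<close>) to \<open>R'\<close> (over \<open>M'\<close>) lifting $f:M\to M'$.\<close>

definition chain_lift ::
  "('o, 'm, 'e) excat \<Rightarrow> ('o, 'm) aug_complex \<Rightarrow> ('o, 'm) aug_complex \<Rightarrow> 'm \<Rightarrow> (nat \<Rightarrow> 'm) \<Rightarrow> bool"
  where "chain_lift \<C> R R' f \<phi> \<longleftrightarrow>
    (\<forall>n. \<phi> n \<in> Mor \<C> (cob R n) (cob R' n)) \<and>
    caug R' \<cdot>\<^bsub>\<C>\<^esub> \<phi> 0 = f \<cdot>\<^bsub>\<C>\<^esub> caug R \<and>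
    (\<forall>n. \<phi> n \<cdot>\<^bsub>\<C>\<^esub> cdif R n = cdif R' n \<cdot>\<^bsub>\<C>\<^esub> \<phi> (Suc n))"


section \<open>Cohomology\<close>

text \<open>
  Cohomology of a cochain complex $0\to X^0\to X^1\to\cdots$ of abelian groups. Induced maps and
  connecting maps are given on cosets by their values on representatives.
\<close>

definition cocycles :: "(nat \<Rightarrow> 'a monoid) \<Rightarrow> (nat \<Rightarrow> 'a \<Rightarrow> 'a) \<Rightarrow> nat \<Rightarrow> 'a set"
  where "cocycles X d n = kernel (X n) (X (Suc n)) (d n)"

definition coboundaries :: "(nat \<Rightarrow> 'a monoid) \<Rightarrow> (nat \<Rightarrow> 'a \<Rightarrow> 'a) \<Rightarrow> nat \<Rightarrow> 'a set"
  where "coboundaries X d n = (case n of 0 \<Rightarrow> {\<one>\<^bsub>X 0\<^esub>} | Suc m \<Rightarrow> d m ` carrier (X m))"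

definition cohomology :: "(nat \<Rightarrow> 'a monoid) \<Rightarrow> (nat \<Rightarrow> 'a \<Rightarrow> 'a) \<Rightarrow> nat \<Rightarrow> 'a set monoid"
  where "cohomology X d n = (X n)\<lparr>carrier := cocycles X d n\<rparr> Mod coboundaries X d n"

definition coh_class :: "(nat \<Rightarrow> 'a monoid) \<Rightarrow> (nat \<Rightarrow> 'a \<Rightarrow> 'a) \<Rightarrow> nat \<Rightarrow> 'a \<Rightarrow> 'a set"
  where "coh_class X d n z = coboundaries X d n #>\<^bsub>X n\<^esub> z"

definition coh_map ::
  "(nat \<Rightarrow> 'a monoid) \<Rightarrow> (nat \<Rightarrow> 'a \<Rightarrow> 'a) \<Rightarrow> (nat \<Rightarrow> 'a \<Rightarrow> 'a) \<Rightarrow> nat \<Rightarrow> 'a set \<Rightarrow> 'a set"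
  where "coh_map Y d \<phi> n c = (\<Union>z \<in> c. coh_class Y d n (\<phi> n z))"

text \<open>
  For a short exact sequence of complexes $0\to X\xrightarrow{\alpha}Y\xrightarrow{\beta}Z\to 0$; \<open>dX\<close> and
  \<open>dY\<close> are the differentials.
\<close>

definition coh_connecting ::
  "(nat \<Rightarrow> 'a monoid) \<Rightarrow> (nat \<Rightarrow> 'a \<Rightarrow> 'a) \<Rightarrow> (nat \<Rightarrow> 'a monoid) \<Rightarrow> (nat \<Rightarrow> 'a \<Rightarrow> 'a) \<Rightarrow>
    (nat \<Rightarrow> 'a \<Rightarrow> 'a) \<Rightarrow> (nat \<Rightarrow> 'a \<Rightarrow> 'a) \<Rightarrow> nat \<Rightarrow> 'a set \<Rightarrow> 'a set"
  where "coh_connecting X dX Y dY \<alpha> \<beta> n c = (THE c'. \<exists>u \<in> carrier (X (Suc n)). \<exists>v \<in> carrier (Y n).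
    \<beta> n v \<in> c \<and> \<alpha> (Suc n) u = dY n v \<and> c' = coh_class X dX (Suc n) u)"

text \<open>
  \<open>xt \<C> R N n\<close> is the group $H^n(\mathcal{C}(\mathbf{R},N))$ of the deleted complex of \<open>R\<close>. It is
  $\xi\mathrm{xt}^n_\xi(M,N)$ if \<open>R\<close> is a $\xi$-projective resolution of $M$, and
  $\xi\mathrm{xt}^n_{\mathcal{GP}(\xi)}(M,N)$ if \<open>R\<close> is a $\xi$-$\mathcal{G}$projective resolution of $M$.
  The resolution stays an explicit argument.
\<close>

definition hom_cx :: "('o, 'm, 'e) excat \<Rightarrow> ('o, 'm) aug_complex \<Rightarrow> 'o \<Rightarrow> nat \<Rightarrow> 'm monoid"
  where "hom_cx \<C> R N n = Hom \<C> (cob R n) N"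

definition hom_dif :: "('o, 'm, 'e) excat \<Rightarrow> ('o, 'm) aug_complex \<Rightarrow> nat \<Rightarrow> 'm \<Rightarrow> 'm"
  where "hom_dif \<C> R n z = z \<cdot>\<^bsub>\<C>\<^esub> cdif R n"

definition xt :: "('o, 'm, 'e) excat \<Rightarrow> ('o, 'm) aug_complex \<Rightarrow> 'o \<Rightarrow> nat \<Rightarrow> 'm set monoid"
  where "xt \<C> R N n = cohomology (hom_cx \<C> R N) (hom_dif \<C> R) n"

text \<open>The map \<open>xt \<C> R N n \<rightarrow> xt \<C> R N' n\<close> induced by $a:N\to N'$.\<close>

definition xt_push ::
  "('o, 'm, 'e) excat \<Rightarrow> ('o, 'm) aug_complex \<Rightarrow> 'o \<Rightarrow> 'm \<Rightarrow> nat \<Rightarrow> 'm set \<Rightarrow> 'm set"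
  where "xt_push \<C> R N' a = coh_map (hom_cx \<C> R N') (hom_dif \<C> R) (\<lambda>n z. a \<cdot>\<^bsub>\<C>\<^esub> z)"

text \<open>The map \<open>xt \<C> R' N n \<rightarrow> xt \<C> R N n\<close> induced by a chain map \<open>\<phi>\<close> from \<open>R\<close> to \<open>R'\<close>.\<close>

definition xt_pull ::
  "('o, 'm, 'e) excat \<Rightarrow> ('o, 'm) aug_complex \<Rightarrow> 'o \<Rightarrow> (nat \<Rightarrow> 'm) \<Rightarrow> nat \<Rightarrow> 'm set \<Rightarrow> 'm set"
  where "xt_pull \<C> R N \<phi> = coh_map (hom_cx \<C> R N) (hom_dif \<C> R) (\<lambda>n z. z \<cdot>\<^bsub>\<C>\<^esub> \<phi> n)"

fun xt_connecting ::
  "('o, 'm, 'e) excat \<Rightarrow> ('o, 'm) aug_complex \<Rightarrow> ('o, 'm, 'e) triangle \<Rightarrow> nat \<Rightarrow> 'm set \<Rightarrow> 'm set"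
  where "xt_connecting \<C> R (N, x, N', y, N'', \<eta>) =
    coh_connecting (hom_cx \<C> R N) (hom_dif \<C> R) (hom_cx \<C> R N') (hom_dif \<C> R)
      (\<lambda>n z. x \<cdot>\<^bsub>\<C>\<^esub> z) (\<lambda>n z. y \<cdot>\<^bsub>\<C>\<^esub> z)"

end

theory Submission
  imports Defs
begin

text \<open>
  Both cohomologies are computed from complexes $\mathcal{C}(\mathbf{R},N)$, and a triangle that is
  exact against every term of $\mathbf{R}$ gives a short exact sequence of such complexes; all
  connecting maps are those of the resulting long exact sequences. A
  $\mathcal{C}(\mathcal{GP}(\xi),-)$-exact triangle in $\xi$ qualifies for $\xi$-$\mathcal{G}$projective and
  for $\xi$-projective resolutions alike. Every triangle in $\xi$ is exact against
  $\mathcal{P}(\xi)$, so the identity of $M$ lifts to a chain map from a $\xi$-projective to a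
  $\xi$-$\mathcal{G}$projective resolution. Pulling back along it gives the comparison maps
  $\delta^i$, and they commute with connecting maps because these are natural.
\<close>

section \<open>Cohomology of cochain complexes\<close>

text \<open>An inflation in an extriangulated category need not be monic, nor a deflation epic, so
  the usual diagram chases cannot be run on a triangle itself. They can be run on its image under
  \<C>(W,-) whenever the triangle is exact against W. Everything is therefore reduced to Hom groups
  out of terms of resolutions, and the homological algebra is done on elements of complexes of
  abelian groups, written multiplicatively. In both kinds of resolution the terms lie in a class
  against which the triangles of that resolution are exact; this already forces consecutive
  differentials to compose to zero. The orientation of the comparison is forced: maps out of a
  \<xi>-projective term lift along every triangle in \<xi>, whereas maps out of a Gorenstein
  projective term need not. By contravariance of \<C>(-,N), a chain map from the projective to the
  Gorenstein resolution yields maps from Gorenstein to ordinary cohomology.\<close>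

locale cochain_complex =
  fixes X :: "nat \<Rightarrow> 'a monoid" and d :: "nat \<Rightarrow> 'a \<Rightarrow> 'a"
  assumes comm_group: "comm_group (X n)"
    and d_hom: "d n \<in> hom (X n) (X (Suc n))"
    and d_d: "z \<in> carrier (X n) \<Longrightarrow> d (Suc n) (d n z) = \<one>\<^bsub>X (Suc (Suc n))\<^esub>"
begin

lemma group: "group (X n)"
  using comm_group by (rule comm_group.axioms(2))

lemma d_group_hom: "group_hom (X n) (X (Suc n)) (d n)"
  by (simp add: group_hom_def group_hom_axioms_def group d_hom)

lemma d_closed: "z \<in> carrier (X n) \<Longrightarrow> d n z \<in> carrier (X (Suc n))"
  using d_hom by (rule hom_in_carrier)

lemma subgroup_cocycles: "subgroup (cocycles X d n) (X n)"
  unfolding cocycles_def by (rule group_hom.subgroup_kernel[OF d_group_hom])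

lemma subgroup_coboundaries: "subgroup (coboundaries X d n) (X n)"
proof (cases n)
  case 0
  then show ?thesis
    by (simp add: coboundaries_def group group.triv_subgroup)
next
  case (Suc m)
  then show ?thesis
    using group_hom.img_is_subgroup[OF d_group_hom] by (simp add: coboundaries_def)
qed

lemma cocycles_closed: "z \<in> cocycles X d n \<Longrightarrow> z \<in> carrier (X n)"
  by (simp add: cocycles_def kernel_def)

lemma coboundaries_closed: "z \<in> coboundaries X d n \<Longrightarrow> z \<in> carrier (X n)"
  by (rule subgroup.mem_carrier[OF subgroup_coboundaries])

lemma coboundaries_subset_cocycles: "coboundaries X d n \<subseteq> cocycles X d n"
proof (cases n)
  case 0
  then show ?thesis
    using subgroup_cocycles[of 0] by (simp add: coboundaries_def subgroup.one_closed)
next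
  case (Suc m)
  then show ?thesis
    by (auto simp: coboundaries_def cocycles_def kernel_def d_closed d_d)
qed

lemma comm_group_cocycles: "comm_group ((X n)\<lparr>carrier := cocycles X d n\<rparr>)"
proof (rule group.group_comm_groupI)
  show "group ((X n)\<lparr>carrier := cocycles X d n\<rparr>)"
    by (rule group.subgroup_imp_group[OF group subgroup_cocycles])
qed (simp add: comm_monoid.m_comm[OF comm_group.axioms(1)[OF comm_group]] cocycles_closed)

lemma normal_coboundaries: "coboundaries X d n \<lhd> (X n)\<lparr>carrier := cocycles X d n\<rparr>"
  using comm_group.subgroup_imp_normal[OF comm_group_cocycles]
    group.subgroup_incl[OF group subgroup_coboundaries subgroup_cocycles
      coboundaries_subset_cocycles] by blast

lemma group_cohomology: "group (cohomology X d n)"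
  unfolding cohomology_def by (rule normal.factorgroup_is_group[OF normal_coboundaries])

text \<open>\<open>cohomology\<close> is a quotient of the subgroup of cocycles, while
  \<open>coh_class\<close> forms its coset in the whole group. A coset depends only on the
  multiplication, which restricting the carrier leaves unchanged, so the library facts on quotient
  groups apply to \<open>coh_class\<close>.\<close>

lemma coh_class_alt:
  "coh_class X d n z = coboundaries X d n #>\<^bsub>(X n)\<lparr>carrier := cocycles X d n\<rparr>\<^esub> z"
  by (simp add: coh_class_def r_coset_def)

lemma carrier_cohomology: "carrier (cohomology X d n) = coh_class X d n ` cocycles X d n"
  by (auto simp: cohomology_def carrier_FactGroup coh_class_alt)

lemma coh_class_closed: "z \<in> cocycles X d n \<Longrightarrow> coh_class X d n z \<in> carrier (cohomology X d n)"
  by (simp add: carrier_cohomology)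

lemma coh_class_mult:
  assumes "z \<in> cocycles X d n" "w \<in> cocycles X d n"
  shows "coh_class X d n z \<otimes>\<^bsub>cohomology X d n\<^esub> coh_class X d n w = coh_class X d n (z \<otimes>\<^bsub>X n\<^esub> w)"
  using normal.rcos_sum[OF normal_coboundaries, of z n w] assms
  by (simp add: cohomology_def coh_class_alt)

lemma coh_class_eq_iff:
  assumes "z \<in> carrier (X n)" "w \<in> carrier (X n)"
  shows "coh_class X d n z = coh_class X d n w \<longleftrightarrow> z \<otimes>\<^bsub>X n\<^esub> inv\<^bsub>X n\<^esub> w \<in> coboundaries X d n"
proof -
  interpret group "X n" by (rule group)
  have "z \<in> coh_class X d n w \<longleftrightarrow> z \<otimes>\<^bsub>X n\<^esub> inv\<^bsub>X n\<^esub> w \<in> coboundaries X d n"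
    unfolding coh_class_def
    using subgroup.rcos_module[OF subgroup_coboundaries is_group assms(2,1)] .
  moreover have "coh_class X d n z = coh_class X d n w \<longleftrightarrow> z \<in> coh_class X d n w"
    unfolding coh_class_def
    by (metis assms(1,2) rcos_self repr_independence subgroup_coboundaries)
  ultimately show ?thesis by simp
qed

lemma coh_class_eqI:
  "\<lbrakk>b \<in> coboundaries X d n; w \<in> carrier (X n)\<rbrakk> \<Longrightarrow> coh_class X d n (b \<otimes>\<^bsub>X n\<^esub> w) = coh_class X d n w"
  using coh_class_eq_iff[of "b \<otimes>\<^bsub>X n\<^esub> w" n w] coboundaries_closed[of b n]
    group.inv_solve_right[OF group, of b n "b \<otimes>\<^bsub>X n\<^esub> w" w]
    monoid.m_closed[OF group.is_monoid[OF group]] by auto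

lemma one_cohomology: "\<one>\<^bsub>cohomology X d n\<^esub> = coboundaries X d n"
  by (simp add: cohomology_def)

lemma coh_class_eq_one_iff:
  assumes "z \<in> carrier (X n)"
  shows "coh_class X d n z = \<one>\<^bsub>cohomology X d n\<^esub> \<longleftrightarrow> z \<in> coboundaries X d n"
proof -
  interpret group "X n" by (rule group)
  have "\<one>\<^bsub>cohomology X d n\<^esub> = coh_class X d n \<one>\<^bsub>X n\<^esub>"
    using coset_mult_one[of "coboundaries X d n"] coboundaries_closed[of _ n]
    by (simp add: one_cohomology coh_class_def subset_iff)
  then show ?thesis using coh_class_eq_iff[OF assms, of "\<one>\<^bsub>X n\<^esub>"] assms by simp
qed

end

section \<open>Cochain maps and the homomorphisms they induce on cohomology\<close>

locale cochain_map = X: cochain_complex X dX + Y: cochain_complex Y dY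
  for X :: "nat \<Rightarrow> 'a monoid" and dX and Y :: "nat \<Rightarrow> 'a monoid" and dY +
  fixes \<phi> :: "nat \<Rightarrow> 'a \<Rightarrow> 'a"
  assumes map_hom: "\<phi> n \<in> hom (X n) (Y n)"
    and map_d: "z \<in> carrier (X n) \<Longrightarrow> \<phi> (Suc n) (dX n z) = dY n (\<phi> n z)"
begin

lemma map_group_hom: "group_hom (X n) (Y n) (\<phi> n)"
  by (simp add: group_hom_def group_hom_axioms_def X.group Y.group map_hom)

lemma map_closed: "z \<in> carrier (X n) \<Longrightarrow> \<phi> n z \<in> carrier (Y n)"
  using map_hom by (rule hom_in_carrier)

lemma map_one: "\<phi> n \<one>\<^bsub>X n\<^esub> = \<one>\<^bsub>Y n\<^esub>"
  by (rule group_hom.hom_one[OF map_group_hom])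

lemma map_mult: "\<lbrakk>z \<in> carrier (X n); w \<in> carrier (X n)\<rbrakk> \<Longrightarrow> \<phi> n (z \<otimes>\<^bsub>X n\<^esub> w) = \<phi> n z \<otimes>\<^bsub>Y n\<^esub> \<phi> n w"
  by (rule hom_mult[OF map_hom])

lemma map_inv: "z \<in> carrier (X n) \<Longrightarrow> \<phi> n (inv\<^bsub>X n\<^esub> z) = inv\<^bsub>Y n\<^esub> \<phi> n z"
  by (rule group_hom.hom_inv[OF map_group_hom])

lemma map_cocycles: "z \<in> cocycles X dX n \<Longrightarrow> \<phi> n z \<in> cocycles Y dY n"
  by (auto simp: cocycles_def kernel_def map_closed map_d[symmetric] map_one)

lemma map_coboundaries: "z \<in> coboundaries X dX n \<Longrightarrow> \<phi> n z \<in> coboundaries Y dY n"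
  by (cases n) (auto simp: coboundaries_def map_one map_d map_closed)

text \<open>\<open>coh_map\<close> is a union over all representatives of a class. Two
  representatives differ by a coboundary, and so do their images; all members of the union thus
  coincide, and since z lies in its own coset the union is not empty.\<close>

lemma coh_map_class:
  assumes z: "z \<in> cocycles X dX n"
  shows "coh_map Y dY \<phi> n (coh_class X dX n z) = coh_class Y dY n (\<phi> n z)"
proof -
  have zc: "z \<in> carrier (X n)" using z by (rule X.cocycles_closed)
  have "coh_class Y dY n (\<phi> n w) = coh_class Y dY n (\<phi> n z)" if "w \<in> coh_class X dX n z" for w
  proof -
    obtain b where b: "b \<in> coboundaries X dX n" "w = b \<otimes>\<^bsub>X n\<^esub> z"
      using \<open>w \<in> coh_class X dX n z\<close> by (auto simp: coh_class_def r_coset_def)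
    then show ?thesis
      using Y.coh_class_eqI[OF map_coboundaries[OF b(1)] map_closed[OF zc]]
      by (simp add: map_mult X.coboundaries_closed zc)
  qed
  moreover have "z \<in> coh_class X dX n z"
    unfolding coh_class_def using group.rcos_self[OF X.group zc X.subgroup_coboundaries] .
  ultimately show ?thesis unfolding coh_map_def by (intro UN_constant_eq) blast+
qed

lemma coh_map_hom: "coh_map Y dY \<phi> n \<in> hom (cohomology X dX n) (cohomology Y dY n)"
proof (rule homI)
  fix c assume "c \<in> carrier (cohomology X dX n)"
  then show "coh_map Y dY \<phi> n c \<in> carrier (cohomology Y dY n)"
    by (auto simp: X.carrier_cohomology coh_map_class map_cocycles Y.coh_class_closed)
next
  fix c c' assume "c \<in> carrier (cohomology X dX n)" "c' \<in> carrier (cohomology X dX n)"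
  then obtain z w where zw: "z \<in> cocycles X dX n" "w \<in> cocycles X dX n"
    "c = coh_class X dX n z" "c' = coh_class X dX n w"
    by (auto simp: X.carrier_cohomology)
  then have "z \<otimes>\<^bsub>X n\<^esub> w \<in> cocycles X dX n"
    using subgroup.m_closed[OF X.subgroup_cocycles] by blast
  with zw show "coh_map Y dY \<phi> n (c \<otimes>\<^bsub>cohomology X dX n\<^esub> c') =
      coh_map Y dY \<phi> n c \<otimes>\<^bsub>cohomology Y dY n\<^esub> coh_map Y dY \<phi> n c'"
    by (simp add: X.coh_class_mult Y.coh_class_mult coh_map_class map_cocycles map_mult
        X.cocycles_closed)
qed

end

section \<open>The long exact cohomology sequence of a short exact sequence of complexes\<close>

locale short_exact_complexes =
  \<alpha>: cochain_map X dX Y dY \<alpha> + \<beta>: cochain_map Y dY Z dZ \<beta>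
  for X :: "nat \<Rightarrow> 'a monoid" and dX and Y :: "nat \<Rightarrow> 'a monoid" and dY
    and Z :: "nat \<Rightarrow> 'a monoid" and dZ and \<alpha> and \<beta> +
  assumes inj: "inj_on (\<alpha> n) (carrier (X n))"
    and surj: "\<beta> n ` carrier (Y n) = carrier (Z n)"
    and exact: "kernel (Y n) (Z n) (\<beta> n) = \<alpha> n ` carrier (X n)"
begin

lemma \<beta>_\<alpha>: "w \<in> carrier (X n) \<Longrightarrow> \<beta> n (\<alpha> n w) = \<one>\<^bsub>Z n\<^esub>"
  using exact[of n] by (auto simp: kernel_def)

lemma \<beta>_surj: "z \<in> carrier (Z n) \<Longrightarrow> \<exists>v \<in> carrier (Y n). \<beta> n v = z"
  by (auto simp flip: surj)

lemma \<beta>_one: "\<lbrakk>v \<in> carrier (Y n); \<beta> n v = \<one>\<^bsub>Z n\<^esub>\<rbrakk> \<Longrightarrow> \<exists>w \<in> carrier (X n). v = \<alpha> n w"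
  using exact[of n] by (auto simp: kernel_def)

text \<open>Injectivity one degree higher reflects the vanishing of the differential.\<close>

lemma \<alpha>_cocycle:
  assumes "w \<in> carrier (X n)" "\<alpha> n w \<in> cocycles Y dY n"
  shows "w \<in> cocycles X dX n"
proof -
  have "\<alpha> (Suc n) (dX n w) = \<alpha> (Suc n) \<one>\<^bsub>X (Suc n)\<^esub>"
    using assms by (simp add: \<alpha>.map_d \<alpha>.map_one cocycles_def kernel_def)
  then have "dX n w = \<one>\<^bsub>X (Suc n)\<^esub>"
    using inj_onD[OF inj] assms(1) \<alpha>.X.d_closed
      monoid.one_closed[OF group.is_monoid[OF \<alpha>.X.group]] by blast
  then show ?thesis using assms(1) by (simp add: cocycles_def kernel_def)
qed

text \<open>By surjectivity of \<beta> one degree lower, a coboundary of Z is the image of a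
  coboundary t of Y; in degree 0 this t is the neutral element. What remains of v after removing t
  is killed by \<beta>, hence comes from X. Both the well-definedness of the connecting map and
  exactness at Y rest on this decomposition.\<close>

lemma \<beta>_coboundary:
  assumes v: "v \<in> carrier (Y n)" and "\<beta> n v \<in> coboundaries Z dZ n"
  shows "\<exists>t \<in> coboundaries Y dY n. \<exists>w \<in> carrier (X n). v = t \<otimes>\<^bsub>Y n\<^esub> \<alpha> n w"
proof -
  interpret group "Y n" by (rule \<alpha>.Y.group)
  have "\<exists>t \<in> coboundaries Y dY n. \<beta> n t = \<beta> n v"
  proof (cases n)
    case 0
    then show ?thesis using assms by (simp add: coboundaries_def \<beta>.map_one)
  next
    case (Suc m)
    then obtain z where z: "z \<in> carrier (Z m)" "\<beta> n v = dZ m z"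
      using assms by (auto simp: coboundaries_def)
    then obtain y where y: "y \<in> carrier (Y m)" "\<beta> m y = z" using \<beta>_surj by blast
    then have "\<beta> n (dY m y) = \<beta> n v" "dY m y \<in> coboundaries Y dY n"
      using z Suc \<beta>.map_d by (auto simp: coboundaries_def)
    then show ?thesis by blast
  qed
  then obtain t where t: "t \<in> coboundaries Y dY n" "\<beta> n t = \<beta> n v" by blast
  then have tc: "t \<in> carrier (Y n)" by (simp add: \<alpha>.Y.coboundaries_closed)
  then have "\<beta> n (inv\<^bsub>Y n\<^esub> t \<otimes>\<^bsub>Y n\<^esub> v) = \<one>\<^bsub>Z n\<^esub>"
    using t v by (simp add: \<beta>.map_mult \<beta>.map_inv \<beta>.map_closed group.l_inv[OF \<beta>.Y.group])
  then obtain w where w: "w \<in> carrier (X n)" "inv\<^bsub>Y n\<^esub> t \<otimes>\<^bsub>Y n\<^esub> v = \<alpha> n w"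
    using \<beta>_one tc v by blast
  then have "v = t \<otimes>\<^bsub>Y n\<^esub> \<alpha> n w"
    using inv_solve_left'[OF \<alpha>.map_closed[OF w(1)] tc v] by simp
  with t w show ?thesis by blast
qed

text \<open>This settles all choices behind the connecting map together: the representative of the
  class in Z, its preimage v, and u. The quotient of v by v' is t times \<alpha> w with t a
  coboundary; the differential kills t and turns \<alpha> w into \<alpha> of \<open>dX n w\<close>,
  so by injectivity u and u' differ by the coboundary \<open>dX n w\<close>.\<close>

lemma connecting_unique:
  assumes u: "u \<in> carrier (X (Suc n))" and v: "v \<in> carrier (Y n)" and e: "\<alpha> (Suc n) u = dY n v"
    and u': "u' \<in> carrier (X (Suc n))" and v': "v' \<in> carrier (Y n)"
    and e': "\<alpha> (Suc n) u' = dY n v'"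
    and b: "\<beta> n v \<otimes>\<^bsub>Z n\<^esub> inv\<^bsub>Z n\<^esub> \<beta> n v' \<in> coboundaries Z dZ n"
  shows "coh_class X dX (Suc n) u = coh_class X dX (Suc n) u'"
proof -
  interpret Y: group "Y n" by (rule \<alpha>.Y.group)
  interpret YS: group "Y (Suc n)" by (rule \<alpha>.Y.group)
  interpret X: group "X (Suc n)" by (rule \<alpha>.X.group)
  interpret d: group_hom "Y n" "Y (Suc n)" "dY n" by (rule \<alpha>.Y.d_group_hom)
  have "\<beta> n (v \<otimes>\<^bsub>Y n\<^esub> inv\<^bsub>Y n\<^esub> v') \<in> coboundaries Z dZ n"
    using b v v' by (simp add: \<beta>.map_mult \<beta>.map_inv)
  then obtain t w where t: "t \<in> coboundaries Y dY n" and w: "w \<in> carrier (X n)"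
    and eq: "v \<otimes>\<^bsub>Y n\<^esub> inv\<^bsub>Y n\<^esub> v' = t \<otimes>\<^bsub>Y n\<^esub> \<alpha> n w"
    using \<beta>_coboundary[of "v \<otimes>\<^bsub>Y n\<^esub> inv\<^bsub>Y n\<^esub> v'" n] v v' by auto
  have tc: "t \<in> carrier (Y n)" using t by (rule \<alpha>.Y.coboundaries_closed)
  have dt: "dY n t = \<one>\<^bsub>Y (Suc n)\<^esub>"
    using t \<alpha>.Y.coboundaries_subset_cocycles by (auto simp: cocycles_def kernel_def)
  have "\<alpha> (Suc n) (u \<otimes>\<^bsub>X (Suc n)\<^esub> inv\<^bsub>X (Suc n)\<^esub> u') = dY n (v \<otimes>\<^bsub>Y n\<^esub> inv\<^bsub>Y n\<^esub> v')"
    using u u' v v' e e' by (simp add: \<alpha>.map_mult \<alpha>.map_inv)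
  also have "\<dots> = \<alpha> (Suc n) (dX n w)"
    unfolding eq using tc w dt by (simp add: \<alpha>.map_closed \<alpha>.map_d \<alpha>.X.d_closed)
  finally have "u \<otimes>\<^bsub>X (Suc n)\<^esub> inv\<^bsub>X (Suc n)\<^esub> u' = dX n w"
    using inj_onD[OF inj] u u' w \<alpha>.X.d_closed by auto
  then show ?thesis
    using \<alpha>.X.coh_class_eq_iff[OF u u'] w by (auto simp: coboundaries_def)
qed

text \<open>The computation rule for the connecting map. It eliminates the definite description, and
  all later arguments evaluate the map through it by exhibiting a pair u, v.\<close>

lemma connecting_eq:
  assumes u: "u \<in> carrier (X (Suc n))" and v: "v \<in> carrier (Y n)" and e: "\<alpha> (Suc n) u = dY n v"
  shows "coh_connecting X dX Y dY \<alpha> \<beta> n (coh_class Z dZ n (\<beta> n v)) = coh_class X dX (Suc n) u"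
  unfolding coh_connecting_def
proof (rule the_equality)
  have "\<beta> n v \<in> coh_class Z dZ n (\<beta> n v)"
    unfolding coh_class_def
    by (rule group.rcos_self[OF \<beta>.Y.group \<beta>.map_closed[OF v] \<beta>.Y.subgroup_coboundaries])
  then show "\<exists>u' \<in> carrier (X (Suc n)). \<exists>v' \<in> carrier (Y n).
    \<beta> n v' \<in> coh_class Z dZ n (\<beta> n v) \<and> \<alpha> (Suc n) u' = dY n v' \<and>
    coh_class X dX (Suc n) u = coh_class X dX (Suc n) u'"
    by (intro bexI[OF _ u] bexI[OF _ v]) (simp add: e)
next
  fix c' assume "\<exists>u' \<in> carrier (X (Suc n)). \<exists>v' \<in> carrier (Y n).
    \<beta> n v' \<in> coh_class Z dZ n (\<beta> n v) \<and> \<alpha> (Suc n) u' = dY n v' \<and>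
    c' = coh_class X dX (Suc n) u'"
  then obtain u' v' where u': "u' \<in> carrier (X (Suc n))" and v': "v' \<in> carrier (Y n)"
    and b: "\<beta> n v' \<in> coh_class Z dZ n (\<beta> n v)" and e': "\<alpha> (Suc n) u' = dY n v'"
    and c': "c' = coh_class X dX (Suc n) u'" by blast
  have "\<beta> n v' \<otimes>\<^bsub>Z n\<^esub> inv\<^bsub>Z n\<^esub> \<beta> n v \<in> coboundaries Z dZ n"
    using b subgroup.rcos_module[OF \<beta>.Y.subgroup_coboundaries \<beta>.Y.group
        \<beta>.map_closed[OF v] \<beta>.map_closed[OF v']]
    by (simp add: coh_class_def)
  then show "c' = coh_class X dX (Suc n) u"
    using connecting_unique[OF u' v' e' u v e] c' by simp
qed

text \<open>The zigzag of the snake lemma: any preimage v of z has a differential killed by \<beta>,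
  which therefore comes from some u. Since \<alpha> u is itself a differential, it is a cocycle, and
  hence so is u.\<close>

lemma cocycle_lift:
  assumes "z \<in> cocycles Z dZ n"
  obtains u v where "u \<in> cocycles X dX (Suc n)" "v \<in> carrier (Y n)" "\<beta> n v = z"
    "\<alpha> (Suc n) u = dY n v"
proof -
  have "z \<in> carrier (Z n)" using assms by (rule \<beta>.Y.cocycles_closed)
  then obtain v where v: "v \<in> carrier (Y n)" "\<beta> n v = z" using \<beta>_surj by blast
  then have "\<beta> (Suc n) (dY n v) = \<one>\<^bsub>Z (Suc n)\<^esub>"
    using assms by (simp add: \<beta>.map_d cocycles_def kernel_def)
  then obtain u where u: "u \<in> carrier (X (Suc n))" "dY n v = \<alpha> (Suc n) u"
    using \<beta>_one \<alpha>.Y.d_closed v by blast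
  have "\<alpha> (Suc n) u \<in> cocycles Y dY (Suc n)"
    using \<alpha>.Y.d_closed[OF v(1)] \<alpha>.Y.d_d[OF v(1)] by (simp add: cocycles_def kernel_def flip: u(2))
  then have "u \<in> cocycles X dX (Suc n)" using \<alpha>_cocycle u by blast
  with that u v show ?thesis by metis
qed

lemma connecting_hom:
  "coh_connecting X dX Y dY \<alpha> \<beta> n \<in> hom (cohomology Z dZ n) (cohomology X dX (Suc n))"
proof (rule homI)
  fix c assume "c \<in> carrier (cohomology Z dZ n)"
  then obtain z where "z \<in> cocycles Z dZ n" "c = coh_class Z dZ n z"
    by (auto simp: \<beta>.Y.carrier_cohomology)
  then show "coh_connecting X dX Y dY \<alpha> \<beta> n c \<in> carrier (cohomology X dX (Suc n))"
    using cocycle_lift connecting_eq \<alpha>.X.cocycles_closed \<alpha>.X.coh_class_closed by metis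
next
  fix c c' assume "c \<in> carrier (cohomology Z dZ n)" "c' \<in> carrier (cohomology Z dZ n)"
  then obtain z z' where z: "z \<in> cocycles Z dZ n" "c = coh_class Z dZ n z"
    and z': "z' \<in> cocycles Z dZ n" "c' = coh_class Z dZ n z'"
    by (auto simp: \<beta>.Y.carrier_cohomology)
  obtain u v where u: "u \<in> cocycles X dX (Suc n)" "v \<in> carrier (Y n)" "\<beta> n v = z"
    "\<alpha> (Suc n) u = dY n v" using cocycle_lift[OF z(1)] .
  obtain u' v' where u': "u' \<in> cocycles X dX (Suc n)" "v' \<in> carrier (Y n)" "\<beta> n v' = z'"
    "\<alpha> (Suc n) u' = dY n v'" using cocycle_lift[OF z'(1)] .
  note cc = \<alpha>.X.cocycles_closed[OF u(1)] \<alpha>.X.cocycles_closed[OF u'(1)]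
  have "\<alpha> (Suc n) (u \<otimes>\<^bsub>X (Suc n)\<^esub> u') = dY n (v \<otimes>\<^bsub>Y n\<^esub> v')"
    using u u' cc by (simp add: \<alpha>.map_mult hom_mult[OF \<alpha>.Y.d_hom])
  moreover have "\<beta> n (v \<otimes>\<^bsub>Y n\<^esub> v') = z \<otimes>\<^bsub>Z n\<^esub> z'" using u u' by (simp add: \<beta>.map_mult)
  ultimately have "coh_connecting X dX Y dY \<alpha> \<beta> n (coh_class Z dZ n (z \<otimes>\<^bsub>Z n\<^esub> z')) =
      coh_class X dX (Suc n) (u \<otimes>\<^bsub>X (Suc n)\<^esub> u')"
    using connecting_eq[of "u \<otimes>\<^bsub>X (Suc n)\<^esub> u'" n "v \<otimes>\<^bsub>Y n\<^esub> v'"] u(2) u'(2) cc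
      monoid.m_closed[OF group.is_monoid[OF \<alpha>.X.group]]
      monoid.m_closed[OF group.is_monoid[OF \<alpha>.Y.group]] by simp
  then show "coh_connecting X dX Y dY \<alpha> \<beta> n (c \<otimes>\<^bsub>cohomology Z dZ n\<^esub> c') =
      coh_connecting X dX Y dY \<alpha> \<beta> n c \<otimes>\<^bsub>cohomology X dX (Suc n)\<^esub>
      coh_connecting X dX Y dY \<alpha> \<beta> n c'"
    using connecting_eq[OF cc(1) u(2,4)] connecting_eq[OF cc(2) u'(2,4)] u(3) u'(3)
    by (simp add: z z' \<beta>.Y.coh_class_mult \<alpha>.X.coh_class_mult u(1) u'(1))
qed

text \<open>In degree 0 the only coboundary is the neutral element, so injectivity of \<alpha>
  passes directly to cohomology. This provides the leading 0 of the long exact sequence.\<close>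

lemma coh_map_mon: "coh_map Y dY \<alpha> 0 \<in> mon (cohomology X dX 0) (cohomology Y dY 0)"
proof -
  have "c = \<one>\<^bsub>cohomology X dX 0\<^esub>"
    if c: "c \<in> carrier (cohomology X dX 0)" "coh_map Y dY \<alpha> 0 c = \<one>\<^bsub>cohomology Y dY 0\<^esub>" for c
  proof -
    obtain z where z: "z \<in> cocycles X dX 0" "c = coh_class X dX 0 z"
      using c by (auto simp: \<alpha>.X.carrier_cohomology)
    have zc: "z \<in> carrier (X 0)" using z(1) by (rule \<alpha>.X.cocycles_closed)
    then have "\<alpha> 0 z = \<alpha> 0 \<one>\<^bsub>X 0\<^esub>"
      using c(2) z \<alpha>.Y.coh_class_eq_one_iff[OF \<alpha>.map_closed[OF zc]]
      by (simp add: \<alpha>.coh_map_class coboundaries_def \<alpha>.map_one)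
    then have "z = \<one>\<^bsub>X 0\<^esub>"
      using inj_onD[OF inj] zc monoid.one_closed[OF group.is_monoid[OF \<alpha>.X.group]] by blast
    then show ?thesis
      using z(2) \<alpha>.X.coh_class_eq_one_iff[OF zc] by (simp add: coboundaries_def)
  qed
  then show ?thesis
    by (simp add: mon_iff_hom_one \<alpha>.X.group_cohomology \<alpha>.Y.group_cohomology \<alpha>.coh_map_hom)
qed

lemma exact_at_Y:
  "kernel (cohomology Y dY n) (cohomology Z dZ n) (coh_map Z dZ \<beta> n) =
    coh_map Y dY \<alpha> n ` carrier (cohomology X dX n)"
proof (intro equalityI subsetI)
  fix c assume "c \<in> kernel (cohomology Y dY n) (cohomology Z dZ n) (coh_map Z dZ \<beta> n)"
  then obtain y where y: "y \<in> cocycles Y dY n" "c = coh_class Y dY n y"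
    and 1: "coh_map Z dZ \<beta> n c = \<one>\<^bsub>cohomology Z dZ n\<^esub>"
    by (auto simp: kernel_def \<alpha>.Y.carrier_cohomology)
  have yc: "y \<in> carrier (Y n)" using y(1) by (rule \<alpha>.Y.cocycles_closed)
  then have "\<beta> n y \<in> coboundaries Z dZ n"
    using 1 y \<beta>.Y.coh_class_eq_one_iff \<beta>.map_closed by (simp add: \<beta>.coh_map_class)
  then obtain t w where t: "t \<in> coboundaries Y dY n" and w: "w \<in> carrier (X n)"
    and eq: "y = t \<otimes>\<^bsub>Y n\<^esub> \<alpha> n w" using \<beta>_coboundary yc by blast
  interpret Y: group "Y n" by (rule \<alpha>.Y.group)
  have tc: "t \<in> cocycles Y dY n" using t \<alpha>.Y.coboundaries_subset_cocycles by blast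
  \<comment> \<open>So far w is only a cochain. As \<alpha> w differs from the cocycle y by the
    coboundary t, it is a cocycle cohomologous to y, and \<alpha> reflects this back to w.\<close>
  have "\<alpha> n w = inv\<^bsub>Y n\<^esub> t \<otimes>\<^bsub>Y n\<^esub> y"
    using eq Y.inv_solve_left[of "\<alpha> n w" t y] yc \<alpha>.map_closed[OF w] \<alpha>.Y.cocycles_closed[OF tc]
    by simp
  then have "\<alpha> n w \<in> cocycles Y dY n"
    using tc y(1) subgroup.m_closed[OF \<alpha>.Y.subgroup_cocycles]
      subgroup.m_inv_closed[OF \<alpha>.Y.subgroup_cocycles] by metis
  then have wz: "w \<in> cocycles X dX n" using \<alpha>_cocycle w by blast
  have "c = coh_map Y dY \<alpha> n (coh_class X dX n w)"
    using \<alpha>.Y.coh_class_eqI[OF t \<alpha>.map_closed[OF w]] eq y by (simp add: \<alpha>.coh_map_class wz)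
  then show "c \<in> coh_map Y dY \<alpha> n ` carrier (cohomology X dX n)"
    using \<alpha>.X.coh_class_closed[OF wz] by blast
next
  fix c assume "c \<in> coh_map Y dY \<alpha> n ` carrier (cohomology X dX n)"
  then obtain w where w: "w \<in> cocycles X dX n" "c = coh_class Y dY n (\<alpha> n w)"
    by (auto simp: \<alpha>.X.carrier_cohomology \<alpha>.coh_map_class)
  then have "coh_map Z dZ \<beta> n c = coh_class Z dZ n \<one>\<^bsub>Z n\<^esub>"
    using \<alpha>.map_cocycles[OF w(1)] \<beta>_\<alpha> \<alpha>.X.cocycles_closed by (simp add: \<beta>.coh_map_class)
  also have "\<dots> = \<one>\<^bsub>cohomology Z dZ n\<^esub>"
    using \<beta>.Y.coh_class_eq_one_iff subgroup.one_closed[OF \<beta>.Y.subgroup_coboundaries]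
      \<beta>.Y.coboundaries_closed by blast
  finally show "c \<in> kernel (cohomology Y dY n) (cohomology Z dZ n) (coh_map Z dZ \<beta> n)"
    using w \<alpha>.map_cocycles \<alpha>.Y.coh_class_closed by (simp add: kernel_def)
qed

lemma exact_at_Z:
  "kernel (cohomology Z dZ n) (cohomology X dX (Suc n)) (coh_connecting X dX Y dY \<alpha> \<beta> n) =
    coh_map Z dZ \<beta> n ` carrier (cohomology Y dY n)"
proof (intro equalityI subsetI)
  fix c assume "c \<in> kernel (cohomology Z dZ n) (cohomology X dX (Suc n))
      (coh_connecting X dX Y dY \<alpha> \<beta> n)"
  then obtain z where z: "z \<in> cocycles Z dZ n" "c = coh_class Z dZ n z"
    and 1: "coh_connecting X dX Y dY \<alpha> \<beta> n c = \<one>\<^bsub>cohomology X dX (Suc n)\<^esub>"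
    by (auto simp: kernel_def \<beta>.Y.carrier_cohomology)
  obtain u v where u: "u \<in> cocycles X dX (Suc n)" "v \<in> carrier (Y n)" "\<beta> n v = z"
    "\<alpha> (Suc n) u = dY n v" using cocycle_lift[OF z(1)] .
  have uc: "u \<in> carrier (X (Suc n))" using u(1) by (rule \<alpha>.X.cocycles_closed)
  have "coh_class X dX (Suc n) u = \<one>\<^bsub>cohomology X dX (Suc n)\<^esub>"
    using 1 connecting_eq[OF uc u(2,4)] u(3) z(2) by simp
  then obtain w where w: "w \<in> carrier (X n)" "u = dX n w"
    using \<alpha>.X.coh_class_eq_one_iff[OF uc] by (auto simp: coboundaries_def)
  interpret Y: group "Y n" by (rule \<alpha>.Y.group)
  interpret YS: group "Y (Suc n)" by (rule \<alpha>.Y.group)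
  interpret Z: group "Z n" by (rule \<beta>.Y.group)
  interpret d: group_hom "Y n" "Y (Suc n)" "dY n" by (rule \<alpha>.Y.d_group_hom)
  \<comment> \<open>The obstruction to v being a cocycle is \<alpha> u, and u is now the coboundary
    of w. Dividing v by \<alpha> w removes the obstruction without changing the image in Z.\<close>
  let ?y = "v \<otimes>\<^bsub>Y n\<^esub> inv\<^bsub>Y n\<^esub> \<alpha> n w"
  have "dY n (\<alpha> n w) = dY n v" using w u(4) \<alpha>.map_d by metis
  then have y: "?y \<in> cocycles Y dY n"
    using w(1) u(2) \<alpha>.map_closed by (simp add: cocycles_def kernel_def)
  have "\<beta> n ?y = z"
    using u(2,3) w(1) by (auto simp: \<beta>.map_mult \<beta>.map_inv \<alpha>.map_closed \<beta>_\<alpha> \<beta>.map_closed)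
  then have "c = coh_map Z dZ \<beta> n (coh_class Y dY n ?y)"
    using y z(2) by (simp add: \<beta>.coh_map_class)
  then show "c \<in> coh_map Z dZ \<beta> n ` carrier (cohomology Y dY n)"
    using \<alpha>.Y.coh_class_closed[OF y] by blast
next
  fix c assume "c \<in> coh_map Z dZ \<beta> n ` carrier (cohomology Y dY n)"
  then obtain y where y: "y \<in> cocycles Y dY n" "c = coh_class Z dZ n (\<beta> n y)"
    by (auto simp: \<alpha>.Y.carrier_cohomology \<beta>.coh_map_class)
  have o: "\<one>\<^bsub>X (Suc n)\<^esub> \<in> coboundaries X dX (Suc n)"
    by (rule subgroup.one_closed[OF \<alpha>.X.subgroup_coboundaries])
  then have oc: "\<one>\<^bsub>X (Suc n)\<^esub> \<in> carrier (X (Suc n))" by (rule \<alpha>.X.coboundaries_closed)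
  \<comment> \<open>The cocycle y may itself serve as the preimage v; its differential is trivial,
    so the neutral element serves as u.\<close>
  have "coh_connecting X dX Y dY \<alpha> \<beta> n c = coh_class X dX (Suc n) \<one>\<^bsub>X (Suc n)\<^esub>"
    unfolding y(2) using y(1) connecting_eq[OF oc, of y]
    by (simp add: \<alpha>.map_one cocycles_def kernel_def)
  also have "\<dots> = \<one>\<^bsub>cohomology X dX (Suc n)\<^esub>"
    using \<alpha>.X.coh_class_eq_one_iff[OF oc] o by blast
  finally show "c \<in> kernel (cohomology Z dZ n) (cohomology X dX (Suc n))
      (coh_connecting X dX Y dY \<alpha> \<beta> n)"
    using y \<beta>.map_cocycles \<beta>.Y.coh_class_closed by (simp add: kernel_def)
qed

lemma exact_at_X:
  "kernel (cohomology X dX (Suc n)) (cohomology Y dY (Suc n)) (coh_map Y dY \<alpha> (Suc n)) =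
    coh_connecting X dX Y dY \<alpha> \<beta> n ` carrier (cohomology Z dZ n)"
proof (intro equalityI subsetI)
  fix c assume "c \<in> kernel (cohomology X dX (Suc n)) (cohomology Y dY (Suc n))
      (coh_map Y dY \<alpha> (Suc n))"
  then obtain u where u: "u \<in> cocycles X dX (Suc n)" "c = coh_class X dX (Suc n) u"
    and 1: "coh_map Y dY \<alpha> (Suc n) c = \<one>\<^bsub>cohomology Y dY (Suc n)\<^esub>"
    by (auto simp: kernel_def \<alpha>.X.carrier_cohomology)
  have uc: "u \<in> carrier (X (Suc n))" using u(1) by (rule \<alpha>.X.cocycles_closed)
  have "\<alpha> (Suc n) u \<in> coboundaries Y dY (Suc n)"
    using 1 u \<alpha>.Y.coh_class_eq_one_iff[OF \<alpha>.map_closed[OF uc]] by (simp add: \<alpha>.coh_map_class)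
  then obtain v where v: "v \<in> carrier (Y n)" "\<alpha> (Suc n) u = dY n v"
    by (auto simp: coboundaries_def)
  \<comment> \<open>The pair u, v is already a zigzag, so the class of \<beta> v is the preimage
    under the connecting map that is sought.\<close>
  have "\<beta> n v \<in> cocycles Z dZ n"
    using v \<beta>.map_closed \<beta>.map_d[OF v(1)] \<beta>_\<alpha>[OF uc] by (simp add: cocycles_def kernel_def)
  then show "c \<in> coh_connecting X dX Y dY \<alpha> \<beta> n ` carrier (cohomology Z dZ n)"
    using connecting_eq[OF uc v] u(2) \<beta>.Y.coh_class_closed by (metis imageI)
next
  fix c assume "c \<in> coh_connecting X dX Y dY \<alpha> \<beta> n ` carrier (cohomology Z dZ n)"
  then obtain z where z: "z \<in> cocycles Z dZ n"
    and c: "c = coh_connecting X dX Y dY \<alpha> \<beta> n (coh_class Z dZ n z)"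
    by (auto simp: \<beta>.Y.carrier_cohomology)
  obtain u v where u: "u \<in> cocycles X dX (Suc n)" "v \<in> carrier (Y n)" "\<beta> n v = z"
    "\<alpha> (Suc n) u = dY n v" using cocycle_lift[OF z(1)] .
  have uc: "u \<in> carrier (X (Suc n))" using u(1) by (rule \<alpha>.X.cocycles_closed)
  have c': "c = coh_class X dX (Suc n) u" using c connecting_eq[OF uc u(2,4)] u(3) by simp
  have "\<alpha> (Suc n) u \<in> coboundaries Y dY (Suc n)" using u by (auto simp: coboundaries_def)
  then have "coh_map Y dY \<alpha> (Suc n) c = \<one>\<^bsub>cohomology Y dY (Suc n)\<^esub>"
    unfolding c' using \<alpha>.Y.coh_class_eq_one_iff[OF \<alpha>.map_closed[OF uc]] u(1)
    by (simp add: \<alpha>.coh_map_class)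
  then show "c \<in> kernel (cohomology X dX (Suc n)) (cohomology Y dY (Suc n))
      (coh_map Y dY \<alpha> (Suc n))"
    using c' u(1) \<alpha>.X.coh_class_closed by (simp add: kernel_def)
qed

text \<open>The segment for n records exactness at Y in degree n, at Z in degree n and at X in
  degree n + 1. As n varies these cover every place of the infinite sequence except X in degree 0,
  which is \<open>coh_map_mon\<close>.\<close>

theorem long_exact:
  "exact_seq
    ([cohomology Y dY (Suc n), cohomology X dX (Suc n), cohomology Z dZ n, cohomology Y dY n,
      cohomology X dX n],
     [coh_map Y dY \<alpha> (Suc n), coh_connecting X dX Y dY \<alpha> \<beta> n, coh_map Z dZ \<beta> n,
      coh_map Y dY \<alpha> n])"
  by (simp add: group_hom_def group_hom_axioms_def \<alpha>.X.group_cohomology \<alpha>.Y.group_cohomology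
      \<beta>.Y.group_cohomology \<alpha>.coh_map_hom \<beta>.coh_map_hom connecting_hom exact_at_X exact_at_Y
      exact_at_Z)

end

text \<open>A zigzag u, v over z is carried to the zigzag f u, g v over h z, and the connecting map
  may be evaluated on any zigzag.\<close>

lemma connecting_natural:
  assumes "short_exact_complexes X dX Y dY Z dZ \<alpha> \<beta>"
    and "short_exact_complexes X' dX' Y' dY' Z' dZ' \<alpha>' \<beta>'"
    and "cochain_map X dX X' dX' f" and "cochain_map Y dY Y' dY' g"
    and "cochain_map Z dZ Z' dZ' h"
    and left: "\<And>n u. u \<in> carrier (X n) \<Longrightarrow> g n (\<alpha> n u) = \<alpha>' n (f n u)"
    and right: "\<And>n v. v \<in> carrier (Y n) \<Longrightarrow> h n (\<beta> n v) = \<beta>' n (g n v)"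
    and c: "c \<in> carrier (cohomology Z dZ n)"
  shows "coh_connecting X' dX' Y' dY' \<alpha>' \<beta>' n (coh_map Z' dZ' h n c) =
    coh_map X' dX' f (Suc n) (coh_connecting X dX Y dY \<alpha> \<beta> n c)"
proof -
  interpret S: short_exact_complexes X dX Y dY Z dZ \<alpha> \<beta> by fact
  interpret S': short_exact_complexes X' dX' Y' dY' Z' dZ' \<alpha>' \<beta>' by fact
  interpret f: cochain_map X dX X' dX' f by fact
  interpret g: cochain_map Y dY Y' dY' g by fact
  interpret h: cochain_map Z dZ Z' dZ' h by fact
  obtain z where z: "z \<in> cocycles Z dZ n" "c = coh_class Z dZ n z"
    using c by (auto simp: S.\<beta>.Y.carrier_cohomology)
  obtain u v where u: "u \<in> cocycles X dX (Suc n)" "v \<in> carrier (Y n)" "\<beta> n v = z"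
    "\<alpha> (Suc n) u = dY n v" using S.cocycle_lift[OF z(1)] .
  have uc: "u \<in> carrier (X (Suc n))" using u(1) by (rule S.\<alpha>.X.cocycles_closed)
  have "\<alpha>' (Suc n) (f (Suc n) u) = dY' n (g n v)"
    using left[OF uc] u(2,4) g.map_d by metis
  then have "coh_connecting X' dX' Y' dY' \<alpha>' \<beta>' n (coh_class Z' dZ' n (\<beta>' n (g n v))) =
      coh_class X' dX' (Suc n) (f (Suc n) u)"
    by (intro S'.connecting_eq f.map_closed g.map_closed uc u)
  then show ?thesis
    using S.connecting_eq[OF uc u(2,4)] right[OF u(2)] z u
    by (simp add: h.coh_map_class f.coh_map_class)
qed


section \<open>Resolutions and their Hom complexes\<close>

context preadditive_category
begin

lemma group_Hom: "\<lbrakk>A \<in> Obj \<C>; B \<in> Obj \<C>\<rbrakk> \<Longrightarrow> group (Hom \<C> A B)"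
  using hom_comm_group by (rule comm_group.axioms(2))

lemma post_hom:
  "\<lbrakk>A \<in> Obj \<C>; B \<in> Obj \<C>; C \<in> Obj \<C>; g \<in> Mor \<C> B C\<rbrakk>
    \<Longrightarrow> (\<lambda>f. g \<cdot> f) \<in> hom (Hom \<C> A B) (Hom \<C> A C)"
  by (rule homI) (auto intro: comp_closed simp: comp_add)

lemma pre_hom:
  "\<lbrakk>A \<in> Obj \<C>; B \<in> Obj \<C>; C \<in> Obj \<C>; f \<in> Mor \<C> A B\<rbrakk>
    \<Longrightarrow> (\<lambda>g. g \<cdot> f) \<in> hom (Hom \<C> B C) (Hom \<C> A C)"
  by (rule homI) (auto intro: comp_closed simp: add_comp)

lemma comp_zero:
  "\<lbrakk>A \<in> Obj \<C>; B \<in> Obj \<C>; C \<in> Obj \<C>; g \<in> Mor \<C> B C\<rbrakk> \<Longrightarrow> g \<cdot> \<one>\<^bsub>Hom \<C> A B\<^esub> = \<one>\<^bsub>Hom \<C> A C\<^esub>"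
  by (rule hom_one[OF post_hom group_Hom group_Hom])

end

lemma cov_exactD:
  assumes "cov_exact \<C> \<W> (A, x, B, y, C, \<delta>)" and "W \<in> \<W>"
  shows "inj_on (\<lambda>f. x \<cdot>\<^bsub>\<C>\<^esub> f) (Mor \<C> W A)"
    and "(\<lambda>f. y \<cdot>\<^bsub>\<C>\<^esub> f) ` Mor \<C> W B = Mor \<C> W C"
    and "kernel (Hom \<C> W B) (Hom \<C> W C) (\<lambda>f. y \<cdot>\<^bsub>\<C>\<^esub> f) = (\<lambda>f. x \<cdot>\<^bsub>\<C>\<^esub> f) ` Mor \<C> W A"
  using assms by (auto simp: short_exact_sequence_iff mon_def epi_def)

lemma cov_exact_Proj: "T \<in> \<xi> \<Longrightarrow> cov_exact \<C> (Proj \<C> \<xi>) T"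
  by (cases T) (auto simp: Proj_def)

lemma Proj_Obj: "Proj \<C> \<xi> \<subseteq> Obj \<C>"
  by (auto simp: Proj_def)

lemma GP_exact_trianglesD:
  "T \<in> GP_exact_triangles \<C> \<xi> \<Longrightarrow> T \<in> \<xi>" "T \<in> GP_exact_triangles \<C> \<xi> \<Longrightarrow> cov_exact \<C> (GProj \<C> \<xi>) T"
  by (simp_all add: GP_exact_triangles_def)

context extriangulated_category
begin

text \<open>\<open>etriangles\<close> constrains the middle term and the two maps only through the
  realization. They are typed correctly because the realization is a class of
  \<open>seq_equiv\<close>, which relates nothing outside \<open>seqs\<close>.\<close>

lemma etriangleD:
  assumes "(A, x, B, y, C, \<delta>) \<in> etriangles \<C>"
  shows "A \<in> Obj \<C>" "B \<in> Obj \<C>" "C \<in> Obj \<C>" "x \<in> Mor \<C> A B" "y \<in> Mor \<C> B C"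
proof -
  show AC: "A \<in> Obj \<C>" "C \<in> Obj \<C>" using assms by (auto simp: etriangles_def)
  have "Rlz \<C> C A \<delta> \<subseteq> seqs \<C> A C"
    using rlz_class[of A C \<delta>] assms
    by (fastforce simp: etriangles_def quotient_def seq_equiv_def Image_def)
  then show "B \<in> Obj \<C>" "x \<in> Mor \<C> A B" "y \<in> Mor \<C> B C"
    using assms by (auto simp: etriangles_def seqs_def)
qed

lemma GProj_Obj:
  assumes "\<xi> \<subseteq> etriangles \<C>"
  shows "GProj \<C> \<xi> \<subseteq> Obj \<C>"
proof
  fix A assume "A \<in> GProj \<C> \<xi>"
  then obtain X d K g f \<theta> n where "complete_proj_resolution \<C> \<xi> X d K g f \<theta>" "A = K n"
    by (auto simp: GProj_def)
  then have "(K (n + 1), g n, X n, f n, A, \<theta> n) \<in> \<xi>"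
    by (simp add: complete_proj_resolution_def)
  then show "A \<in> Obj \<C>" using assms etriangleD(3) by blast
qed

text \<open>This forgets syzygies, triangles and augmentation and keeps what the Hom complexes
  require, so that the lemmas on \<open>xt\<close> serve both kinds of resolution.\<close>

definition deleted_complex :: "('a, 'b) aug_complex \<Rightarrow> bool"
  where "deleted_complex R \<longleftrightarrow> (\<forall>n. cob R n \<in> Obj \<C> \<and>
    cdif R n \<in> Mor \<C> (cob R (Suc n)) (cob R n) \<and>
    cdif R n \<cdot> cdif R (Suc n) = \<one>\<^bsub>Hom \<C> (cob R (Suc (Suc n))) (cob R n)\<^esub>)"

text \<open>The vanishing is obtained on maps out of a test object W, as the inclusion of image in
  kernel in the Hom sequence of W.\<close>

lemma cov_exact_comp_zero:
  assumes "T = (K, g, X, f, K', \<theta>)" and "T \<in> etriangles \<C>" and "cov_exact \<C> \<W> T"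
    and "W \<in> \<W>" and "W \<in> Obj \<C>" and "h \<in> Mor \<C> W K"
  shows "f \<cdot> (g \<cdot> h) = \<one>\<^bsub>Hom \<C> W K'\<^esub>"
  using cov_exactD(3)[of \<C> \<W> K g X f K' \<theta> W] assms by (auto simp: kernel_def)

lemma resolution_deleted_complex:
  assumes R: "resolution_by \<C> \<X> \<T> M R" and T: "\<T> \<subseteq> etriangles \<C>" and X: "\<X> \<subseteq> Obj \<C>"
    and ex: "\<And>T. T \<in> \<T> \<Longrightarrow> cov_exact \<C> \<X> T"
  shows "deleted_complex R"
proof -
  obtain K g f \<theta> where "\<forall>n. cob R n \<in> \<X> \<and> (K (Suc n), g n, cob R n, f n, K n, \<theta> n) \<in> \<T> \<and>
      cdif R n = g n \<cdot> f (Suc n)"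
    using R unfolding resolution_by_def by blast
  then have r: "\<And>n. cob R n \<in> \<X>" "\<And>n. (K (Suc n), g n, cob R n, f n, K n, \<theta> n) \<in> \<T>"
    "\<And>n. cdif R n = g n \<cdot> f (Suc n)" by blast+
  note t = etriangleD[OF subsetD[OF T r(2)]]
  show ?thesis
    unfolding deleted_complex_def
  proof (intro allI conjI)
    fix n
    show "cob R n \<in> Obj \<C>" by (rule t)
    show "cdif R n \<in> Mor \<C> (cob R (Suc n)) (cob R n)"
      unfolding r(3) by (intro comp_closed[of _ "K (Suc n)"] t)
    \<comment> \<open>The test object is the source \<open>cob R (Suc (Suc n))\<close> of the
      composite, and the map out of it is the deflation onto the next syzygy.\<close>
    have "f (Suc n) \<cdot> (g (Suc n) \<cdot> f (Suc (Suc n))) =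
        \<one>\<^bsub>Hom \<C> (cob R (Suc (Suc n))) (K (Suc n))\<^esub>"
      using cov_exact_comp_zero[OF refl subsetD[OF T r(2)] ex[OF r(2)] r(1) t(2) t(5)] .
    moreover have "cdif R n \<cdot> cdif R (Suc n) = g n \<cdot> (f (Suc n) \<cdot> (g (Suc n) \<cdot> f (Suc (Suc n))))"
      unfolding r(3)
      by (rule comp_assoc) (rule t comp_closed[of _ "K (Suc (Suc n))"])+
    ultimately show "cdif R n \<cdot> cdif R (Suc n) = \<one>\<^bsub>Hom \<C> (cob R (Suc (Suc n))) (cob R n)\<^esub>"
      using comp_zero[OF t(2) t(3) t(2) t(4)] by simp
  qed
qed

lemma hom_cochain_complex:
  assumes "deleted_complex R" and "N \<in> Obj \<C>"
  shows "cochain_complex (hom_cx \<C> R N) (hom_dif \<C> R)"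
proof (rule cochain_complex.intro)
  note R = assms(1)[unfolded deleted_complex_def, rule_format]
  fix n
  show "comm_group (hom_cx \<C> R N n)" using R assms(2) by (simp add: hom_cx_def hom_comm_group)
  show "hom_dif \<C> R n \<in> hom (hom_cx \<C> R N n) (hom_cx \<C> R N (Suc n))"
    using pre_hom[of "cob R (Suc n)" "cob R n" N "cdif R n"] R assms(2)
    by (simp add: hom_cx_def hom_dif_def[abs_def])
  fix z assume z: "z \<in> carrier (hom_cx \<C> R N n)"
  have "(z \<cdot> cdif R n) \<cdot> cdif R (Suc n) = z \<cdot> (cdif R n \<cdot> cdif R (Suc n))"
    using R assms(2) z
    by (intro comp_assoc[of "cob R (Suc (Suc n))" "cob R (Suc n)" "cob R n" N]) (auto simp: hom_cx_def)
  then show "hom_dif \<C> R (Suc n) (hom_dif \<C> R n z) = \<one>\<^bsub>hom_cx \<C> R N (Suc (Suc n))\<^esub>"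
    using R assms(2) z by (simp add: hom_cx_def hom_dif_def comp_zero)
qed

lemma push_cochain_map:
  assumes R: "deleted_complex R" and N: "N \<in> Obj \<C>" "N' \<in> Obj \<C>" and a: "a \<in> Mor \<C> N N'"
  shows "cochain_map (hom_cx \<C> R N) (hom_dif \<C> R) (hom_cx \<C> R N') (hom_dif \<C> R) (\<lambda>n z. a \<cdot> z)"
proof (intro cochain_map.intro cochain_map_axioms.intro hom_cochain_complex assms)
  note R' = R[unfolded deleted_complex_def, rule_format]
  fix n
  show "(\<lambda>z. a \<cdot> z) \<in> hom (hom_cx \<C> R N n) (hom_cx \<C> R N' n)"
    unfolding hom_cx_def by (intro post_hom) (use R' N a in auto)
  fix z assume "z \<in> carrier (hom_cx \<C> R N n)"
  then show "a \<cdot> hom_dif \<C> R n z = hom_dif \<C> R n (a \<cdot> z)"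
    using R' N a comp_assoc[of "cob R (Suc n)" "cob R n" N N' "cdif R n" z a]
    by (auto simp: hom_cx_def hom_dif_def)
qed

lemma pull_cochain_map:
  assumes R: "deleted_complex R" and R': "deleted_complex R'" and N: "N \<in> Obj \<C>"
    and \<phi>: "chain_lift \<C> R R' f \<phi>"
  shows "cochain_map (hom_cx \<C> R' N) (hom_dif \<C> R') (hom_cx \<C> R N) (hom_dif \<C> R) (\<lambda>n z. z \<cdot> \<phi> n)"
proof (intro cochain_map.intro cochain_map_axioms.intro hom_cochain_complex assms)
  note r = R[unfolded deleted_complex_def, rule_format] R'[unfolded deleted_complex_def, rule_format]
  have m: "\<phi> n \<in> Mor \<C> (cob R n) (cob R' n)" "\<phi> n \<cdot> cdif R n = cdif R' n \<cdot> \<phi> (Suc n)" for n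
    using \<phi> by (auto simp: chain_lift_def)
  fix n
  show "(\<lambda>z. z \<cdot> \<phi> n) \<in> hom (hom_cx \<C> R' N n) (hom_cx \<C> R N n)"
    unfolding hom_cx_def by (intro pre_hom) (use r m N in auto)
  fix z assume z: "z \<in> carrier (hom_cx \<C> R' N n)"
  have "(z \<cdot> cdif R' n) \<cdot> \<phi> (Suc n) = z \<cdot> (cdif R' n \<cdot> \<phi> (Suc n))"
    using r m N z by (intro comp_assoc[of "cob R (Suc n)" "cob R' (Suc n)" "cob R' n" N]) (auto simp: hom_cx_def)
  moreover have "(z \<cdot> \<phi> n) \<cdot> cdif R n = z \<cdot> (\<phi> n \<cdot> cdif R n)"
    using r m(1) N z by (intro comp_assoc[of "cob R (Suc n)" "cob R n" "cob R' n" N]) (auto simp: hom_cx_def)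
  ultimately show "hom_dif \<C> R' n z \<cdot> \<phi> (Suc n) = hom_dif \<C> R n (z \<cdot> \<phi> n)"
    using m(2) by (simp add: hom_dif_def)
qed

lemma triangle_short_exact:
  assumes R: "deleted_complex R" and T: "(N, x, N', y, N'', \<eta>) \<in> etriangles \<C>"
    and ex: "cov_exact \<C> \<W> (N, x, N', y, N'', \<eta>)" and W: "\<And>n. cob R n \<in> \<W>"
  shows "short_exact_complexes (hom_cx \<C> R N) (hom_dif \<C> R) (hom_cx \<C> R N') (hom_dif \<C> R)
    (hom_cx \<C> R N'') (hom_dif \<C> R) (\<lambda>n z. x \<cdot> z) (\<lambda>n z. y \<cdot> z)"
  using cov_exactD[OF ex W]
  by (intro short_exact_complexes.intro short_exact_complexes_axioms.intro push_cochain_map R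
      etriangleD[OF T]) (simp_all add: hom_cx_def)

text \<open>The two resolutions may have their terms in different classes, provided the triangle is
  exact against both. The same lemma thus yields naturality in M, with Gorenstein resolutions on
  both sides, and the square relating the two cohomologies.\<close>

lemma xt_connecting_pull:
  assumes R: "deleted_complex R" and R': "deleted_complex R'" and \<phi>: "chain_lift \<C> R R' f \<phi>"
    and T: "(N, x, N', y, N'', \<eta>) \<in> etriangles \<C>"
    and ex: "cov_exact \<C> \<W> (N, x, N', y, N'', \<eta>)" and W: "\<And>n. cob R n \<in> \<W>"
    and ex': "cov_exact \<C> \<W>' (N, x, N', y, N'', \<eta>)" and W': "\<And>n. cob R' n \<in> \<W>'"
    and c: "c \<in> carrier (xt \<C> R' N'' i)"
  shows "xt_connecting \<C> R (N, x, N', y, N'', \<eta>) i (xt_pull \<C> R N'' \<phi> i c) =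
    xt_pull \<C> R N \<phi> (Suc i) (xt_connecting \<C> R' (N, x, N', y, N'', \<eta>) i c)"
proof -
  note t = etriangleD[OF T]
  note r = R[unfolded deleted_complex_def, rule_format] R'[unfolded deleted_complex_def, rule_format]
  have m: "\<phi> n \<in> Mor \<C> (cob R n) (cob R' n)" for n using \<phi> by (auto simp: chain_lift_def)
  have "a \<cdot> z \<cdot> \<phi> n = (a \<cdot> z) \<cdot> \<phi> n"
    if "A \<in> Obj \<C>" "B \<in> Obj \<C>" "a \<in> Mor \<C> A B" "z \<in> Mor \<C> (cob R' n) A" for A B a z n
    using comp_assoc[of "cob R n" "cob R' n" A B "\<phi> n" z a] that r m by simp
  then show ?thesis
    unfolding xt_connecting.simps xt_pull_def
    by (intro connecting_natural[OF triangle_short_exact[OF R' T ex' W']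
          triangle_short_exact[OF R T ex W] pull_cochain_map[OF R R' t(1) \<phi>]
          pull_cochain_map[OF R R' t(2) \<phi>] pull_cochain_map[OF R R' t(3) \<phi>]])
      (use t c in \<open>auto simp: hom_cx_def xt_def\<close>)
qed

lemma xt_connecting_push:
  assumes R: "deleted_complex R" and W: "\<And>n. cob R n \<in> \<W>"
    and T: "(N, x, N', y, N'', \<eta>) \<in> etriangles \<C>" "cov_exact \<C> \<W> (N, x, N', y, N'', \<eta>)"
    and S: "(L, u, L', v, L'', \<zeta>) \<in> etriangles \<C>" "cov_exact \<C> \<W> (L, u, L', v, L'', \<zeta>)"
    and m: "triangle_mor \<C> (N, x, N', y, N'', \<eta>) (L, u, L', v, L'', \<zeta>) a b c"
    and k: "k \<in> carrier (xt \<C> R N'' i)"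
  shows "xt_connecting \<C> R (L, u, L', v, L'', \<zeta>) i (xt_push \<C> R L'' c i k) =
    xt_push \<C> R L a (Suc i) (xt_connecting \<C> R (N, x, N', y, N'', \<eta>) i k)"
proof -
  note t = etriangleD[OF T(1)] and s = etriangleD[OF S(1)]
  have r: "cob R n \<in> Obj \<C>" for n using R by (simp add: deleted_complex_def)
  have m': "a \<in> Mor \<C> N L" "b \<in> Mor \<C> N' L'" "c \<in> Mor \<C> N'' L''" "b \<cdot> x = u \<cdot> a" "v \<cdot> b = c \<cdot> y"
    using m by auto
  have l: "b \<cdot> x \<cdot> z = u \<cdot> a \<cdot> z" if "z \<in> Mor \<C> (cob R n) N" for z n
    using comp_assoc[of "cob R n" N N' L' z x b] comp_assoc[of "cob R n" N L L' z a u]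
      that t s r m' by simp
  have "c \<cdot> y \<cdot> z = v \<cdot> b \<cdot> z" if "z \<in> Mor \<C> (cob R n) N'" for z n
    using comp_assoc[of "cob R n" N' N'' L'' z y c] comp_assoc[of "cob R n" N' L' L'' z b v]
      that t s r m' by simp
  with l show ?thesis
    unfolding xt_connecting.simps xt_push_def
    by (intro connecting_natural[OF triangle_short_exact[OF R T W]
          triangle_short_exact[OF R S W] push_cochain_map[OF R t(1) s(1) m'(1)]
          push_cochain_map[OF R t(2) s(2) m'(2)] push_cochain_map[OF R t(3) s(3) m'(3)]])
      (use k in \<open>auto simp: hom_cx_def xt_def\<close>)
qed

section \<open>Lifting the identity of M between two kinds of resolution\<close>

lemma lift_through:
  assumes ex: "cov_exact \<C> \<W> (A, x, B, y, C, \<delta>)" and W: "W \<in> \<W>" and h: "h \<in> Mor \<C> W C"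
  shows "\<exists>k \<in> Mor \<C> W B. y \<cdot> k = h"
  using cov_exactD(2)[OF ex W] h by force

text \<open>
  The syzygies of \<open>P\<close> need not be in \<open>\<P>\<close>, so no maps between syzygies are constructed:
  in each degree the composite \<open>\<phi> n \<cdot> cdif P n\<close>, whose source is a term of \<open>P\<close>, is
  factored through the syzygy of \<open>G\<close>, and the invariant \<open>Q\<close> says that this is possible.
\<close>

lemma comparison:
  assumes P: "resolution_by \<C> \<P> \<S> M P" and G: "resolution_by \<C> \<X> \<T> M G"
    and S: "\<S> \<subseteq> etriangles \<C>" "\<And>T. T \<in> \<S> \<Longrightarrow> cov_exact \<C> \<P> T"
    and T: "\<T> \<subseteq> etriangles \<C>" "\<And>T. T \<in> \<T> \<Longrightarrow> cov_exact \<C> \<P> T"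
  shows "\<exists>\<phi>. chain_lift \<C> P G (Idn \<C> M) \<phi>"
proof -
  obtain K g f \<theta> where p0: "K 0 = M" "caug P = f 0"
    and "\<forall>n. cob P n \<in> \<P> \<and> (K (Suc n), g n, cob P n, f n, K n, \<theta> n) \<in> \<S> \<and>
      cdif P n = g n \<cdot> f (Suc n)"
    using P unfolding resolution_by_def by blast
  then have p: "\<And>n. cob P n \<in> \<P>" "\<And>n. (K (Suc n), g n, cob P n, f n, K n, \<theta> n) \<in> \<S>"
    "\<And>n. cdif P n = g n \<cdot> f (Suc n)" by blast+
  obtain L h k \<kappa> where q0: "L 0 = M" "caug G = k 0"
    and "\<forall>n. cob G n \<in> \<X> \<and> (L (Suc n), h n, cob G n, k n, L n, \<kappa> n) \<in> \<T> \<and>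
      cdif G n = h n \<cdot> k (Suc n)"
    using G unfolding resolution_by_def by blast
  then have q: "\<And>n. (L (Suc n), h n, cob G n, k n, L n, \<kappa> n) \<in> \<T>"
    "\<And>n. cdif G n = h n \<cdot> k (Suc n)" by blast+
  note t = etriangleD[OF subsetD[OF S(1) p(2)]] and s = etriangleD[OF subsetD[OF T(1) q(1)]]
  note exq = T(2)[OF q(1)]
  have dP: "cdif P n \<in> Mor \<C> (cob P (Suc n)) (cob P n)" for n
    unfolding p(3) by (intro comp_closed[of _ "K (Suc n)"] t)
  have fd: "f n \<cdot> cdif P n = \<one>\<^bsub>Hom \<C> (cob P (Suc n)) (K n)\<^esub>" for n
    unfolding p(3)
    using cov_exact_comp_zero[OF refl subsetD[OF S(1) p(2)] S(2)[OF p(2)] p(1) t(2) t(5)] .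
  define Q where "Q n \<phi> \<longleftrightarrow> \<phi> \<in> Mor \<C> (cob P n) (cob G n) \<and>
    k n \<cdot> (\<phi> \<cdot> cdif P n) = \<one>\<^bsub>Hom \<C> (cob P (Suc n)) (L n)\<^esub>" for n \<phi>
  have base: "\<exists>\<phi>. Q 0 \<phi> \<and> k 0 \<cdot> \<phi> = f 0"
  proof -
    have "f 0 \<in> Mor \<C> (cob P 0) (L 0)" using t(5)[of 0] p0(1) q0(1) by simp
    then obtain \<phi> where \<phi>: "\<phi> \<in> Mor \<C> (cob P 0) (cob G 0)" "k 0 \<cdot> \<phi> = f 0"
      using lift_through[OF exq p(1)] by blast
    have "k 0 \<cdot> (\<phi> \<cdot> cdif P 0) = (k 0 \<cdot> \<phi>) \<cdot> cdif P 0"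
      by (rule comp_assoc[symmetric]) (rule t s dP \<phi>)+
    then show ?thesis using \<phi> fd[of 0] p0(1) q0(1) by (auto simp: Q_def)
  qed
  have step: "\<exists>\<psi>. Q (Suc n) \<psi> \<and> \<phi> \<cdot> cdif P n = cdif G n \<cdot> \<psi>" if "Q n \<phi>" for n \<phi>
  proof -
    have \<phi>: "\<phi> \<in> Mor \<C> (cob P n) (cob G n)"
      "k n \<cdot> (\<phi> \<cdot> cdif P n) = \<one>\<^bsub>Hom \<C> (cob P (Suc n)) (L n)\<^esub>"
      using that by (auto simp: Q_def)
    \<comment> \<open>The invariant places the composite in the kernel of \<open>k n\<close>.
      Exactness against \<open>cob P (Suc n)\<close> factors it through the syzygy
      \<open>L (Suc n)\<close>, and then lifts the factor l to the next term of G.\<close>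
    have "\<phi> \<cdot> cdif P n \<in> kernel (Hom \<C> (cob P (Suc n)) (cob G n)) (Hom \<C> (cob P (Suc n)) (L n))
        (\<lambda>f. k n \<cdot> f)"
      unfolding kernel_def using \<phi> comp_closed[OF t(2) t(2) s(2) dP \<phi>(1)] by simp
    then obtain l where l: "l \<in> Mor \<C> (cob P (Suc n)) (L (Suc n))" "\<phi> \<cdot> cdif P n = h n \<cdot> l"
      using cov_exactD(3)[OF exq p(1)] by auto
    obtain \<psi> where \<psi>: "\<psi> \<in> Mor \<C> (cob P (Suc n)) (cob G (Suc n))" "k (Suc n) \<cdot> \<psi> = l"
      using lift_through[OF exq p(1) l(1)] by blast
    have e: "cdif G n \<cdot> \<psi> = h n \<cdot> l"
      unfolding q(2) \<psi>(2)[symmetric] by (rule comp_assoc) (rule t s \<psi>)+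
    let ?d = "cdif P (Suc n)"
    \<comment> \<open>To propagate the invariant it suffices to check the vanishing after composing
      with \<open>h n\<close>, which is injective on maps out of \<open>cob P (Suc (Suc n))\<close>.
      There the composite becomes \<phi> followed after two consecutive differentials of P, which is
      zero.\<close>
    have "h n \<cdot> (k (Suc n) \<cdot> (\<psi> \<cdot> ?d)) = h n \<cdot> (l \<cdot> ?d)"
      unfolding \<psi>(2)[symmetric] by (subst comp_assoc) (rule t s \<psi> dP refl)+
    also have "\<dots> = (h n \<cdot> l) \<cdot> ?d"
      by (rule comp_assoc[symmetric]) (rule t s l dP)+
    also have "\<dots> = \<phi> \<cdot> (cdif P n \<cdot> ?d)"
      unfolding l(2)[symmetric] by (rule comp_assoc) (rule t s \<phi> dP)+
    also have "cdif P n \<cdot> ?d = g n \<cdot> (f (Suc n) \<cdot> ?d)"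
      unfolding p(3)[of n] by (rule comp_assoc) (rule t dP)+
    also have "\<phi> \<cdot> \<dots> = \<one>\<^bsub>Hom \<C> (cob P (Suc (Suc n))) (cob G n)\<^esub>"
      unfolding fd comp_zero[OF t(2) t(3) t(2) t(4)] by (rule comp_zero) (rule t s \<phi>)+
    also have "\<dots> = h n \<cdot> \<one>\<^bsub>Hom \<C> (cob P (Suc (Suc n))) (L (Suc n))\<^esub>"
      by (rule comp_zero[symmetric]) (rule t s)+
    finally have "k (Suc n) \<cdot> (\<psi> \<cdot> ?d) = \<one>\<^bsub>Hom \<C> (cob P (Suc (Suc n))) (L (Suc n))\<^esub>"
      by (rule inj_onD[OF cov_exactD(1)[OF exq p(1)]])
        ((rule comp_closed t s \<psi> dP)+, rule monoid.one_closed[OF group.is_monoid[OF group_Hom]],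
          (rule t s)+)
    then show ?thesis using \<psi>(1) e l(2) by (auto simp: Q_def)
  qed
  obtain \<phi>0 where \<phi>0: "Q 0 \<phi>0" "k 0 \<cdot> \<phi>0 = f 0" using base by blast
  obtain \<phi> where \<phi>: "\<phi> 0 = \<phi>0" "\<And>n. Q n (\<phi> n)"
    "\<And>n. \<phi> n \<cdot> cdif P n = cdif G n \<cdot> \<phi> (Suc n)"
  proof -
    \<comment> \<open>The invariant alone does not contain the augmentation equation; the clause for
      n = 0 pins the start of the dependent choice to a map that satisfies it.\<close>
    have "\<exists>\<phi>. \<forall>n. (Q n (\<phi> n) \<and> (n = 0 \<longrightarrow> \<phi> n = \<phi>0)) \<and>
        \<phi> n \<cdot> cdif P n = cdif G n \<cdot> \<phi> (Suc n)"
      using \<phi>0(1) step by (intro dependent_nat_choice) auto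
    then show ?thesis using that by blast
  qed
  have "f 0 \<in> Mor \<C> (cob P 0) M" "M \<in> Obj \<C>" using t(3,5)[of 0] p0(1) by auto
  then have "Idn \<C> M \<cdot> f 0 = f 0" using id_comp t(2) by blast
  then have "chain_lift \<C> P G (Idn \<C> M) \<phi>"
    using \<phi> \<phi>0(2) by (auto simp: chain_lift_def Q_def p0(2) q0(2))
  then show ?thesis by blast
qed

lemma xt_pull_hom:
  assumes "deleted_complex R" and "deleted_complex R'" and "N \<in> Obj \<C>"
    and "chain_lift \<C> R R' f \<phi>"
  shows "xt_pull \<C> R N \<phi> i \<in> hom (xt \<C> R' N i) (xt \<C> R N i)"
  unfolding xt_pull_def xt_def by (rule cochain_map.coh_map_hom[OF pull_cochain_map[OF assms]])

end

text \<open>Both families are chosen before M, the resolutions and the triangles, so that naturality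
  speaks of one fixed family. Commuting squares of homomorphisms alone would admit zero maps as
  \<Delta>; requiring \<Delta> to be induced by a chain map over the identity of M rules out such an
  arbitrary choice.\<close>

theorem proposition3p6:
  fixes \<C> :: "('o, 'm, 'e) excat" and \<xi> :: "('o, 'm, 'e) triangle set"
  assumes "extriangulated_category \<C>" and "WIC \<C>" and "proper_class \<C> \<xi>"
    and "enough_projectives \<C> \<xi>" and "enough_injectives \<C> \<xi>"
  shows
    "\<exists>(\<epsilon> :: nat \<Rightarrow> 'o \<Rightarrow> ('o, 'm) aug_complex \<Rightarrow> ('o, 'm, 'e) triangle \<Rightarrow> 'm set \<Rightarrow> 'm set)
       (\<Delta> :: nat \<Rightarrow> 'o \<Rightarrow> ('o, 'm) aug_complex \<Rightarrow> ('o, 'm) aug_complex \<Rightarrow> 'o \<Rightarrow> 'm set \<Rightarrow> 'm set).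
      (\<forall>M \<in> finite_Gpd \<C> \<xi>. \<forall>G. Gproj_resolution \<C> \<xi> M G \<longrightarrow>
        (\<forall>N x N' y N'' \<eta>. (N, x, N', y, N'', \<eta>) \<in> GP_exact_triangles \<C> \<xi> \<longrightarrow>
          xt_push \<C> G N' x 0 \<in> mon (xt \<C> G N 0) (xt \<C> G N' 0) \<and>
          (\<forall>n. exact_seq
            ([xt \<C> G N' (Suc n), xt \<C> G N (Suc n), xt \<C> G N'' n, xt \<C> G N' n, xt \<C> G N n],
             [xt_push \<C> G N' x (Suc n), \<epsilon> n M G (N, x, N', y, N'', \<eta>),
              xt_push \<C> G N'' y n, xt_push \<C> G N' x n])))) \<and>
      (\<forall>M \<in> finite_Gpd \<C> \<xi>. \<forall>M' \<in> finite_Gpd \<C> \<xi>. \<forall>f \<in> Mor \<C> M M'. \<forall>G G' \<phi>.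
        Gproj_resolution \<C> \<xi> M G \<and> Gproj_resolution \<C> \<xi> M' G' \<and> chain_lift \<C> G G' f \<phi> \<longrightarrow>
        (\<forall>N x N' y N'' \<eta>. (N, x, N', y, N'', \<eta>) \<in> GP_exact_triangles \<C> \<xi> \<longrightarrow>
          (\<forall>i. \<forall>c \<in> carrier (xt \<C> G' N'' i).
            \<epsilon> i M G (N, x, N', y, N'', \<eta>) (xt_pull \<C> G N'' \<phi> i c) =
            xt_pull \<C> G N \<phi> (Suc i) (\<epsilon> i M' G' (N, x, N', y, N'', \<eta>) c)))) \<and>
      (\<forall>M \<in> finite_Gpd \<C> \<xi>. \<forall>G. Gproj_resolution \<C> \<xi> M G \<longrightarrow>
        (\<forall>N x N' y N'' \<eta> L u L' v L'' \<zeta> a b c.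
          (N, x, N', y, N'', \<eta>) \<in> GP_exact_triangles \<C> \<xi> \<and>
          (L, u, L', v, L'', \<zeta>) \<in> GP_exact_triangles \<C> \<xi> \<and>
          triangle_mor \<C> (N, x, N', y, N'', \<eta>) (L, u, L', v, L'', \<zeta>) a b c \<longrightarrow>
          (\<forall>i. \<forall>k \<in> carrier (xt \<C> G N'' i).
            \<epsilon> i M G (L, u, L', v, L'', \<zeta>) (xt_push \<C> G L'' c i k) =
            xt_push \<C> G L a (Suc i) (\<epsilon> i M G (N, x, N', y, N'', \<eta>) k)))) \<and>
      (\<forall>M \<in> finite_Gpd \<C> \<xi>. \<forall>G P. Gproj_resolution \<C> \<xi> M G \<and> proj_resolution \<C> \<xi> M P \<longrightarrow>
        (\<exists>\<phi>. chain_lift \<C> P G (Idn \<C> M) \<phi> \<and>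
          (\<forall>i. \<forall>N \<in> Obj \<C>. \<forall>c \<in> carrier (xt \<C> G N i). \<Delta> i M G P N c = xt_pull \<C> P N \<phi> i c)) \<and>
        (\<forall>i. \<forall>N \<in> Obj \<C>. \<Delta> i M G P N \<in> hom (xt \<C> G N i) (xt \<C> P N i)) \<and>
        (\<forall>N x N' y N'' \<eta>. (N, x, N', y, N'', \<eta>) \<in> GP_exact_triangles \<C> \<xi> \<longrightarrow>
          (\<forall>i. \<forall>c \<in> carrier (xt \<C> G N'' i).
            \<Delta> (Suc i) M G P N (\<epsilon> i M G (N, x, N', y, N'', \<eta>) c) =
            xt_connecting \<C> P (N, x, N', y, N'', \<eta>) i (\<Delta> i M G P N'' c))))"
proof -
  interpret extriangulated_category \<C> by fact
  interpret proper_class \<C> \<xi> by fact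
  let ?GT = "GP_exact_triangles \<C> \<xi>"
  have GT: "T \<in> etriangles \<C>" "cov_exact \<C> (GProj \<C> \<xi>) T" "cov_exact \<C> (Proj \<C> \<xi>) T"
    if "T \<in> ?GT" for T
    using that etriangle GP_exact_trianglesD cov_exact_Proj by blast+
  have G: "deleted_complex G" "\<And>n. cob G n \<in> GProj \<C> \<xi>" if "Gproj_resolution \<C> \<xi> M G" for M G
  proof -
    note r = that[unfolded Gproj_resolution_def]
    show "deleted_complex G"
      by (rule resolution_deleted_complex[OF r _ GProj_Obj[OF etriangle]]) (use GT in blast)+
    show "cob G n \<in> GProj \<C> \<xi>" for n using r by (auto simp: resolution_by_def)
  qed
  have P: "deleted_complex P" "\<And>n. cob P n \<in> Proj \<C> \<xi>" if "proj_resolution \<C> \<xi> M P" for M P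
  proof -
    note r = that[unfolded proj_resolution_def]
    show "deleted_complex P"
      by (rule resolution_deleted_complex[OF r etriangle Proj_Obj cov_exact_Proj])
    show "cob P n \<in> Proj \<C> \<xi>" for n using r by (auto simp: resolution_by_def)
  qed
  have lift: "\<exists>\<phi>. chain_lift \<C> P G (Idn \<C> M) \<phi>"
    if "proj_resolution \<C> \<xi> M P" "Gproj_resolution \<C> \<xi> M G" for M G P
    by (rule comparison[OF that[unfolded proj_resolution_def Gproj_resolution_def] etriangle
          cov_exact_Proj]) (use GT in blast)+
  define \<epsilon> :: "nat \<Rightarrow> 'o \<Rightarrow> ('o, 'm) aug_complex \<Rightarrow> ('o, 'm, 'e) triangle \<Rightarrow> 'm set \<Rightarrow> 'm set"
    where "\<epsilon> i M G T = xt_connecting \<C> G T i" for i M G T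
  \<comment> \<open>The chain map is chosen independently of the degree and of N, because the square
    compares \<Delta> in degree i at N'' with \<Delta> in degree i + 1 at N.\<close>
  define \<Phi> where "\<Phi> M G P = (SOME \<phi>. chain_lift \<C> P G (Idn \<C> M) \<phi>)" for M G P
  define \<Delta> :: "nat \<Rightarrow> 'o \<Rightarrow> ('o, 'm) aug_complex \<Rightarrow> ('o, 'm) aug_complex \<Rightarrow> 'o \<Rightarrow> 'm set \<Rightarrow> 'm set"
    where "\<Delta> i M G P N = xt_pull \<C> P N (\<Phi> M G P) i" for i M G P N
  have \<Phi>: "chain_lift \<C> P G (Idn \<C> M) (\<Phi> M G P)"
    if "proj_resolution \<C> \<xi> M P" "Gproj_resolution \<C> \<xi> M G" for M G P
    unfolding \<Phi>_def by (rule someI_ex[OF lift[OF that]])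
  show ?thesis
  proof (rule exI[of _ \<epsilon>], rule exI[of _ \<Delta>], intro conjI ballI allI impI; (elim conjE)?)
    fix M G N x N' y N'' \<eta>
    assume r: "Gproj_resolution \<C> \<xi> M G" and t: "(N, x, N', y, N'', \<eta>) \<in> ?GT"
    interpret S: short_exact_complexes "hom_cx \<C> G N" "hom_dif \<C> G" "hom_cx \<C> G N'" "hom_dif \<C> G"
      "hom_cx \<C> G N''" "hom_dif \<C> G" "\<lambda>n z. x \<cdot>\<^bsub>\<C>\<^esub> z" "\<lambda>n z. y \<cdot>\<^bsub>\<C>\<^esub> z"
      by (rule triangle_short_exact[OF G(1)[OF r] GT(1,2)[OF t] G(2)[OF r]])
    show "xt_push \<C> G N' x 0 \<in> mon (xt \<C> G N 0) (xt \<C> G N' 0)"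
      unfolding xt_push_def xt_def by (rule S.coh_map_mon)
    show "exact_seq
            ([xt \<C> G N' (Suc n), xt \<C> G N (Suc n), xt \<C> G N'' n, xt \<C> G N' n, xt \<C> G N n],
             [xt_push \<C> G N' x (Suc n), \<epsilon> n M G (N, x, N', y, N'', \<eta>),
              xt_push \<C> G N'' y n, xt_push \<C> G N' x n])" for n
      unfolding xt_push_def xt_def \<epsilon>_def xt_connecting.simps by (rule S.long_exact)
  next
    fix M M' f G G' \<phi> N x N' y N'' \<eta> i c
    assume r: "Gproj_resolution \<C> \<xi> M G" "Gproj_resolution \<C> \<xi> M' G'"
      and \<phi>: "chain_lift \<C> G G' f \<phi>" and t: "(N, x, N', y, N'', \<eta>) \<in> ?GT"
      and c: "c \<in> carrier (xt \<C> G' N'' i)"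
    show "\<epsilon> i M G (N, x, N', y, N'', \<eta>) (xt_pull \<C> G N'' \<phi> i c) =
        xt_pull \<C> G N \<phi> (Suc i) (\<epsilon> i M' G' (N, x, N', y, N'', \<eta>) c)"
      unfolding \<epsilon>_def
      by (rule xt_connecting_pull[OF G(1)[OF r(1)] G(1)[OF r(2)] \<phi> GT(1,2)[OF t] G(2)[OF r(1)]
            GT(2)[OF t] G(2)[OF r(2)] c])
  next
    fix M G N x N' y N'' \<eta> L u L' v L'' \<zeta> a b c i k
    assume r: "Gproj_resolution \<C> \<xi> M G" and t: "(N, x, N', y, N'', \<eta>) \<in> ?GT"
      and s: "(L, u, L', v, L'', \<zeta>) \<in> ?GT"
      and m: "triangle_mor \<C> (N, x, N', y, N'', \<eta>) (L, u, L', v, L'', \<zeta>) a b c"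
      and k: "k \<in> carrier (xt \<C> G N'' i)"
    show "\<epsilon> i M G (L, u, L', v, L'', \<zeta>) (xt_push \<C> G L'' c i k) =
        xt_push \<C> G L a (Suc i) (\<epsilon> i M G (N, x, N', y, N'', \<eta>) k)"
      unfolding \<epsilon>_def
      by (rule xt_connecting_push[OF G(1)[OF r] G(2)[OF r] GT(1,2)[OF t] GT(1,2)[OF s] m k])
  next
    fix M G P
    assume r: "Gproj_resolution \<C> \<xi> M G" and p: "proj_resolution \<C> \<xi> M P"
    show "\<exists>\<phi>. chain_lift \<C> P G (Idn \<C> M) \<phi> \<and>
        (\<forall>i. \<forall>N \<in> Obj \<C>. \<forall>c \<in> carrier (xt \<C> G N i). \<Delta> i M G P N c = xt_pull \<C> P N \<phi> i c)"
      using \<Phi>[OF p r] by (auto simp: \<Delta>_def)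
    show "\<Delta> i M G P N \<in> hom (xt \<C> G N i) (xt \<C> P N i)" if "N \<in> Obj \<C>" for i N
      unfolding \<Delta>_def by (rule xt_pull_hom[OF P(1)[OF p] G(1)[OF r] that \<Phi>[OF p r]])
    fix N x N' y N'' \<eta> i c
    assume t: "(N, x, N', y, N'', \<eta>) \<in> ?GT" and c: "c \<in> carrier (xt \<C> G N'' i)"
    show "\<Delta> (Suc i) M G P N (\<epsilon> i M G (N, x, N', y, N'', \<eta>) c) =
        xt_connecting \<C> P (N, x, N', y, N'', \<eta>) i (\<Delta> i M G P N'' c)"
      unfolding \<epsilon>_def \<Delta>_def
      by (rule xt_connecting_pull[OF P(1)[OF p] G(1)[OF r] \<Phi>[OF p r] GT(1,3)[OF t] P(2)[OF p]
            GT(2)[OF t] G(2)[OF r] c, symmetric])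
  qed
qed

end
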